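(* The class of graphic Polish groups has the following closure properties. (1) If a Polish group $\Gamma$ is the internal product $\Gamma=\Gamma_1\Gamma_2\cdots\Gamma_n$ of subgroups $\Gamma_1,\dots,\Gamma_n$ which are graphic Polish groups, then $\Gamma$ is graphic; in particular a product of finitely many graphic Polish groups is graphic, and a semidirect product of two graphic Polish groups is graphic. (2) If a Polish group $\Gamma$ is the union $\Gamma=\bigcup_{n\ge1}\Gamma_n$ of countably many subgroups which are graphic Polish groups, then $\Gamma$ is graphic. (3) A Polish group which is a quotient of a graphic Polish group is graphic. (4) If $\Delta$ is a closed subgroup of countable index in a graphic Polish group $\Gamma$, then $\Delta$ is graphic.
   Context: A Polish group $\Gamma$ is graphic if for every Borel action of $\Gamma$ on a Polish space $X$, the orbit equivalence relation is Borel graphable, i.e. equals the connectedness relation (related iff joined by a finite path) of some Borel graph on $X$. *)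

theory Defs
  imports
    "HOL-Analysis.Analysis"
    "HOL-Algebra.Group_Action"
    "HOL-Algebra.Product_Groups"
begin

definition polish_top :: "'a topology \<Rightarrow> bool" where
  "polish_top X \<longleftrightarrow> completely_metrizable_space X \<and> second_countable X"

definition borel_of :: "'a topology \<Rightarrow> 'a measure" where
  "borel_of X = sigma (topspace X) {U. openin X U}"

definition topological_group :: "('a, 'm) monoid_scheme \<Rightarrow> 'a topology \<Rightarrow> bool" where
  "topological_group G T \<longleftrightarrow>
     group G \<and> topspace T = carrier G \<and>
     continuous_map (prod_topology T T) T (\<lambda>(x, y). x \<otimes>\<^bsub>G\<^esub> y) \<and>
     continuous_map T T (\<lambda>x. inv\<^bsub>G\<^esub> x)"

definition polish_group :: "('a, 'm) monoid_scheme \<Rightarrow> 'a topology \<Rightarrow> bool" where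
  "polish_group G T \<longleftrightarrow> topological_group G T \<and> polish_top T"

definition borel_action ::
  "('a, 'm) monoid_scheme \<Rightarrow> 'a topology \<Rightarrow> 'x topology \<Rightarrow> ('a \<Rightarrow> 'x \<Rightarrow> 'x) \<Rightarrow> bool" where
  "borel_action G T X \<phi> \<longleftrightarrow>
     group_action G (topspace X) \<phi> \<and>
     (\<lambda>(g, x). \<phi> g x) \<in> measurable (borel_of (prod_topology T X)) (borel_of X)"

definition orbit_eqrel ::
  "('a, 'm) monoid_scheme \<Rightarrow> 'x topology \<Rightarrow> ('a \<Rightarrow> 'x \<Rightarrow> 'x) \<Rightarrow> ('x \<times> 'x) set" where
  "orbit_eqrel G X \<phi> = {(x, y). x \<in> topspace X \<and> y \<in> orbit G \<phi> x}"

definition borel_graph :: "'x topology \<Rightarrow> ('x \<times> 'x) set \<Rightarrow> bool" where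
  "borel_graph X R \<longleftrightarrow> R \<in> sets (borel_of (prod_topology X X)) \<and> sym R \<and> irrefl R"

text \<open>Paths of length 0 are allowed, so every point is connected to itself.\<close>

definition connectedness_rel :: "'x topology \<Rightarrow> ('x \<times> 'x) set \<Rightarrow> ('x \<times> 'x) set" where
  "connectedness_rel X R = R\<^sup>* \<inter> (topspace X \<times> topspace X)"

definition borel_graphable :: "'x topology \<Rightarrow> ('x \<times> 'x) set \<Rightarrow> bool" where
  "borel_graphable X E \<longleftrightarrow> (\<exists>R. borel_graph X R \<and> E = connectedness_rel X R)"

text \<open>
  HOL cannot quantify over all types inside a definition. A Polish space has at most
  continuum many points, hence is homeomorphic to one whose points are elements of
  \<^typ>\<open>nat set\<close>; quantifying over those loses nothing. The lemma
  \<open>graphic_polish_group_any_space\<close> below proves this.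
\<close>

definition graphic_polish_group :: "('a, 'm) monoid_scheme \<Rightarrow> 'a topology \<Rightarrow> bool" where
  "graphic_polish_group G T \<longleftrightarrow>
     polish_group G T \<and>
     (\<forall>(X :: nat set topology) \<phi>. polish_top X \<and> borel_action G T X \<phi> \<longrightarrow>
        borel_graphable X (orbit_eqrel G X \<phi>))"

text \<open>The external semidirect product, with \<open>H\<close> acting on \<open>N\<close> by automorphisms \<open>\<alpha> h\<close>.\<close>

definition semidirect_product ::
  "('a, 'm) monoid_scheme \<Rightarrow> ('b, 'n) monoid_scheme \<Rightarrow> ('b \<Rightarrow> 'a \<Rightarrow> 'a) \<Rightarrow> ('a \<times> 'b) monoid" where
  "semidirect_product N H \<alpha> =
     \<lparr>carrier = carrier N \<times> carrier H,
      mult = (\<lambda>(n, h) (n', h'). (n \<otimes>\<^bsub>N\<^esub> \<alpha> h n', h \<otimes>\<^bsub>H\<^esub> h')),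
      one = (\<one>\<^bsub>N\<^esub>, \<one>\<^bsub>H\<^esub>)\<rparr>"

lemma space_borel_of [simp]: "space (borel_of X) = topspace X"
  by (simp add: borel_of_def space_measure_of_conv)

lemma sets_borel_of: "sets (borel_of X) = sigma_sets (topspace X) {U. openin X U}"
  unfolding borel_of_def by (rule sets_measure_of) (auto dest: openin_subset)

lemma continuous_map_measurable_borel_of:
  assumes "continuous_map X Y f"
  shows "f \<in> measurable (borel_of X) (borel_of Y)"
proof -
  have "f \<in> measurable (borel_of X) (sigma (topspace Y) {U. openin Y U})"
  proof (rule measurable_measure_of)
    show "{U. openin Y U} \<subseteq> Pow (topspace Y)"
      by (auto dest: openin_subset)
    show "f \<in> space (borel_of X) \<rightarrow> topspace Y"
      using assms by (simp add: continuous_map_def)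
    fix U assume "U \<in> {U. openin Y U}"
    then have "openin X {x \<in> topspace X. f x \<in> U}"
      using assms by (simp add: continuous_map_def)
    moreover have "{x \<in> topspace X. f x \<in> U} = f -` U \<inter> space (borel_of X)"
      by auto
    ultimately show "f -` U \<inter> space (borel_of X) \<in> sets (borel_of X)"
      by (auto simp: sets_borel_of)
  qed
  then show ?thesis
    by (simp add: borel_of_def)
qed

lemma polish_top_homeomorphic_nat_set:
  fixes X :: "'x topology"
  assumes "polish_top X"
  obtains Y :: "nat set topology" and e d where "polish_top Y" "homeomorphic_maps X Y e d"
proof -
  obtain \<B> where \<B>: "countable \<B>"
    and base: "\<forall>U x. openin X U \<and> x \<in> U \<longrightarrow> (\<exists>V\<in>\<B>. x \<in> V \<and> V \<subseteq> U)"
    using assms unfolding polish_top_def second_countable_def by metis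
  have t1: "t1_space X"
    using assms unfolding polish_top_def
    by (simp add: completely_metrizable_imp_metrizable_space metrizable_imp_t1_space)
  define e where "e x = to_nat_on \<B> ` {V \<in> \<B>. x \<in> V}" for x
  have inj: "inj_on e (topspace X)"
  proof (rule inj_onI, rule ccontr)
    fix x y assume xy: "x \<in> topspace X" "y \<in> topspace X" "e x = e y" "x \<noteq> y"
    then obtain U where "openin X U" "x \<in> U" "y \<notin> U"
      using t1 unfolding t1_space_def by blast
    then obtain V where V: "V \<in> \<B>" "x \<in> V" "y \<notin> V"
      using base by blast
    then have "to_nat_on \<B> V \<in> e y"
      using xy(3) by (auto simp: e_def)
    then show False
      using V \<B> by (auto simp: e_def)
  qed
  define d where "d = inv_into (topspace X) e"
  define Y where "Y = pullback_topology (e ` topspace X) d X"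
  have de: "d (e x) = x" if "x \<in> topspace X" for x
    using that inj by (simp add: d_def)
  have topY: "topspace Y = e ` topspace X"
    by (auto simp: Y_def topspace_pullback_topology de)
  have "homeomorphic_maps X Y e d"
    unfolding homeomorphic_maps_def
  proof (intro conjI ballI)
    show "continuous_map X Y e"
      unfolding continuous_map_def
    proof (intro conjI allI impI)
      show "e \<in> topspace X \<rightarrow> topspace Y"
        by (simp add: topY)
      fix U assume "openin Y U"
      then obtain W where W: "openin X W" "U = d -` W \<inter> e ` topspace X"
        by (auto simp: Y_def openin_pullback_topology)
      then have "{x \<in> topspace X. e x \<in> U} = W"
        using openin_subset[OF W(1)] by (auto simp: de)
      then show "openin X {x \<in> topspace X. e x \<in> U}"
        using W by simp
    qed
    show "continuous_map Y X d"
      unfolding continuous_map_def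
    proof (intro conjI allI impI)
      show "d \<in> topspace Y \<rightarrow> topspace X"
        by (auto simp: topY de)
      fix U assume "openin X U"
      moreover have "{y \<in> topspace Y. d y \<in> U} = d -` U \<inter> e ` topspace X"
        by (auto simp: topY)
      ultimately show "openin Y {y \<in> topspace Y. d y \<in> U}"
        by (auto simp: Y_def openin_pullback_topology)
    qed
  qed (auto simp: topY de)
  moreover from this have "X homeomorphic_space Y"
    by (auto simp: homeomorphic_space_def)
  then have "polish_top Y"
    using assms unfolding polish_top_def
    by (metis homeomorphic_completely_metrizable_space homeomorphic_space_second_countability)
  ultimately show ?thesis
    using that by blast
qed

lemma group_action_conjugate:
  assumes act: "group_action G A \<phi>"
    and e: "e \<in> A \<rightarrow> B" and d: "d \<in> B \<rightarrow> A"
    and de: "\<And>x. x \<in> A \<Longrightarrow> d (e x) = x" and ed: "\<And>y. y \<in> B \<Longrightarrow> e (d y) = y"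
  shows "group_action G B (\<lambda>g. \<lambda>y\<in>B. e (\<phi> g (d y)))"
proof -
  interpret group_action G A \<phi> by (rule act)
  interpret G: group G using group_hom by (simp add: group_hom_def)
  let ?\<psi> = "\<lambda>g. \<lambda>y\<in>B. e (\<phi> g (d y))"
  have cl: "\<phi> g x \<in> A" if "g \<in> carrier G" "x \<in> A" for g x
    using that element_image by blast
  have bij: "?\<psi> g \<in> Bij B" if g: "g \<in> carrier G" for g
  proof -
    have inv: "\<phi> (inv\<^bsub>G\<^esub> g) (\<phi> g x) = x" "\<phi> g (\<phi> (inv\<^bsub>G\<^esub> g) x) = x" if "x \<in> A" for x
      using orbit_sym_aux[OF g that refl] orbit_sym_aux[OF G.inv_closed[OF g] that refl] g
      by simp_all
    have "bij_betw (?\<psi> g) B B"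
      by (rule bij_betw_byWitness[where f' = "?\<psi> (inv\<^bsub>G\<^esub> g)"])
        (use g e d in \<open>auto simp: Pi_iff de ed cl inv\<close>)
    then show ?thesis
      by (simp add: Bij_def)
  qed
  have "?\<psi> (g \<otimes>\<^bsub>G\<^esub> h) = compose B (?\<psi> g) (?\<psi> h)" if "g \<in> carrier G" "h \<in> carrier G" for g h
    using that e d by (auto simp: compose_def fun_eq_iff Pi_iff de cl composition_rule)
  then have "?\<psi> \<in> hom G (BijGroup B)"
    using bij by (auto simp: hom_def BijGroup_def)
  then show ?thesis
    unfolding group_action_def group_hom_def group_hom_axioms_def
    by (simp add: G.is_group group_BijGroup)
qed

lemma graphic_polish_group_any_space:
  fixes X :: "'x topology"
  assumes G: "graphic_polish_group G T" and X: "polish_top X" and act: "borel_action G T X \<phi>"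
  shows "borel_graphable X (orbit_eqrel G X \<phi>)"
proof -
  obtain Y :: "nat set topology" and e d
    where Y: "polish_top Y" and hm: "homeomorphic_maps X Y e d"
    using polish_top_homeomorphic_nat_set[OF X] .
  have e: "continuous_map X Y e" and d: "continuous_map Y X d"
    and de: "\<And>x. x \<in> topspace X \<Longrightarrow> d (e x) = x" and ed: "\<And>y. y \<in> topspace Y \<Longrightarrow> e (d y) = y"
    using hm by (auto simp: homeomorphic_maps_def)
  have ein: "e x \<in> topspace Y" if "x \<in> topspace X" for x
    using e that by (auto simp: continuous_map_def)
  have din: "d y \<in> topspace X" if "y \<in> topspace Y" for y
    using d that by (auto simp: continuous_map_def)
  interpret group_action G "topspace X" \<phi>
    using act by (simp add: borel_action_def)
  define \<psi> where "\<psi> g = (\<lambda>y\<in>topspace Y. e (\<phi> g (d y)))" for g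
  have "group_action G (topspace Y) \<psi>"
    unfolding \<psi>_def
    by (rule group_action_conjugate[where A = "topspace X"])
      (use ein din de ed group_action_axioms in auto)
  moreover have "(\<lambda>(g, y). \<psi> g y) \<in> measurable (borel_of (prod_topology T Y)) (borel_of Y)"
  proof -
    have "continuous_map (prod_topology T Y) (prod_topology T X) (\<lambda>(g, y). (g, d y))"
      using d by (subst continuous_map_prod_top) auto
    then have "e \<circ> (\<lambda>(g, x). \<phi> g x) \<circ> (\<lambda>(g, y). (g, d y))
        \<in> measurable (borel_of (prod_topology T Y)) (borel_of Y)"
      using act continuous_map_measurable_borel_of[OF e] unfolding borel_action_def
      by (blast intro: measurable_comp continuous_map_measurable_borel_of)
    then show ?thesis
      by (rule measurable_cong[THEN iffD1, rotated]) (auto simp: \<psi>_def)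
  qed
  ultimately have "borel_action G T Y \<psi>"
    by (simp add: borel_action_def)
  then obtain R where R: "borel_graph Y R" and orb: "orbit_eqrel G Y \<psi> = connectedness_rel Y R"
    using G Y unfolding graphic_polish_group_def borel_graphable_def by blast
  have Rsub: "R \<subseteq> topspace Y \<times> topspace Y"
    using R sets.sets_into_space[of R "borel_of (prod_topology Y Y)"] by (simp add: borel_graph_def)
  define S where "S = {(x, y) \<in> topspace X \<times> topspace X. (e x, e y) \<in> R}"
  have "borel_graph X S"
    unfolding borel_graph_def
  proof (intro conjI)
    have "continuous_map (prod_topology X X) (prod_topology Y Y) (\<lambda>(x, y). (e x, e y))"
      using e by (subst continuous_map_prod_top) auto
    then have "(\<lambda>(x, y). (e x, e y)) -` R \<inter> space (borel_of (prod_topology X X))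
        \<in> sets (borel_of (prod_topology X X))"
      using R unfolding borel_graph_def
      by (meson continuous_map_measurable_borel_of measurable_sets)
    moreover have "(\<lambda>(x, y). (e x, e y)) -` R \<inter> space (borel_of (prod_topology X X)) = S"
      by (auto simp: S_def)
    ultimately show "S \<in> sets (borel_of (prod_topology X X))"
      by simp
    show "sym S" "irrefl S"
      using R by (auto simp: borel_graph_def S_def sym_def irrefl_def)
  qed
  moreover have "orbit_eqrel G X \<phi> = connectedness_rel X S"
  proof -
    have 1: "(e x, e y) \<in> R\<^sup>*" if "(x, y) \<in> S\<^sup>*" for x y
      using that by induction (auto simp: S_def intro: rtrancl_into_rtrancl)
    have 2: "(d x, d y) \<in> S\<^sup>*" if "(x, y) \<in> R\<^sup>*" for x y
      using that
    proof induction
      case (step y z)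
      then have "(d y, d z) \<in> S"
        using Rsub by (auto simp: S_def din ed)
      with step show ?case
        by (auto intro: rtrancl_into_rtrancl)
    qed auto
    have conn: "(x, y) \<in> connectedness_rel X S \<longleftrightarrow> (e x, e y) \<in> connectedness_rel Y R"
      if "x \<in> topspace X" "y \<in> topspace X" for x y
      using that 1[of x y] 2[of "e x" "e y"] by (auto simp: connectedness_rel_def ein de)
    have orbs: "(x, y) \<in> orbit_eqrel G X \<phi> \<longleftrightarrow> (e x, e y) \<in> orbit_eqrel G Y \<psi>"
      if "x \<in> topspace X" "y \<in> topspace X" for x y
    proof -
      have "y = \<phi> g x \<longleftrightarrow> e y = e (\<phi> g x)" if "g \<in> carrier G" for g
        by (metis de element_image that \<open>x \<in> topspace X\<close> \<open>y \<in> topspace X\<close>)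
      then have "(\<exists>g\<in>carrier G. y = \<phi> g x) \<longleftrightarrow> (\<exists>g\<in>carrier G. e y = e (\<phi> g x))"
        by blast
      moreover have "(x, y) \<in> orbit_eqrel G X \<phi> \<longleftrightarrow> (\<exists>g\<in>carrier G. y = \<phi> g x)"
        using that by (auto simp: orbit_eqrel_def orbit_def)
      moreover have "(e x, e y) \<in> orbit_eqrel G Y \<psi> \<longleftrightarrow> (\<exists>g\<in>carrier G. e y = e (\<phi> g x))"
        using that by (auto simp: orbit_eqrel_def orbit_def \<psi>_def ein de)
      ultimately show ?thesis
        by simp
    qed
    have "orbit_eqrel G X \<phi> \<subseteq> topspace X \<times> topspace X"
      using element_image by (auto simp: orbit_eqrel_def orbit_def)
    moreover have "connectedness_rel X S \<subseteq> topspace X \<times> topspace X"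
      by (auto simp: connectedness_rel_def)
    ultimately show ?thesis
      using conn orbs orb by auto
  qed
  ultimately show ?thesis
    by (auto simp: borel_graphable_def)
qed

end

theory Submission
  imports Defs
begin

text \<open>
  If countably many graphic groups map continuously to \<open>G\<close> and their images generate \<open>G\<close>, then
  \<open>G\<close> is graphic: given an action of \<open>G\<close>, the union of Borel graphs for the restricted actions is
  a Borel graph whose connected components are the \<open>G\<close>-orbits. This gives internal products,
  direct and semidirect products, countable unions and quotients. For a closed subgroup \<open>D\<close> of
  countable index, an action of \<open>D\<close> on \<open>X\<close> induces an action of \<open>G\<close> on \<open>X \<times> D\<setminus>G\<close> whose orbit
  relation is the pullback of that of \<open>D\<close> along the projection to \<open>X\<close>; projecting a Borel graph
  along this countable-to-one map yields a Borel graph on \<open>X\<close>.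
\<close>

section \<open>Borel sets and Polish spaces\<close>

text \<open>Graphs behave better than orbit relations here. An orbit relation may fail to be Borel,
  but a union of graphs has as connectedness relation the equivalence relation generated by the
  separate ones, and the orbit relation of a group is generated in the same way by those of any
  generating family. Countability of the family keeps the union Borel.

  Closed subgroups need the opposite direction: an action of \<open>D\<close> on \<open>X\<close>
  need not extend to \<open>G\<close>, so the space is enlarged by the coset space. Closedness of
  \<open>D\<close> makes \<open>D\<close> Polish in the subspace topology, and it makes
  "\<open>g\<close> moves the coset \<open>C\<close> to \<open>C'\<close>" a closed condition on
  \<open>g\<close>, which is why the induced action is Borel. Projections of Borel sets need not be
  Borel in general, but here the fibre is countable and discrete: the projected graph is a countable
  union of preimages of the graph upstairs under the continuous maps that attach a fixed pair of
  cosets. An edge that changes only the coset would project to a loop, so the diagonal is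
  removed.\<close>

lemma closedin_sets_borel_of: "closedin X C \<Longrightarrow> C \<in> sets (borel_of X)"
proof -
  assume "closedin X C"
  then have C: "C \<subseteq> topspace X" "openin X (topspace X - C)"
    by (auto simp: closedin_def)
  then have "topspace X - C \<in> sets (borel_of X)"
    by (simp add: sets_borel_of)
  from sets.compl_sets[OF this] show ?thesis
    using C by (simp add: double_diff)
qed

text \<open>Every open set of the subspace is the trace of an open set of \<open>X\<close>, so the
  identity is measurable from the trace sigma-algebra to the Borel algebra of the subspace. It
  allows a map to be glued from pieces studied in their subspace topologies.\<close>

lemma measurable_restrict_space_borel_of:
  assumes "f \<in> measurable (borel_of (subtopology X A)) M"
  shows "f \<in> measurable (restrict_space (borel_of X) A) M"
proof -
  let ?R = "restrict_space (borel_of X) A"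
  have R: "space ?R = A \<inter> topspace X"
    by (simp add: space_restrict_space)
  have "id \<in> measurable ?R (borel_of (subtopology X A))"
    unfolding borel_of_def[of "subtopology X A"]
  proof (rule measurable_measure_of)
    show "{U. openin (subtopology X A) U} \<subseteq> Pow (topspace (subtopology X A))"
      by (intro subsetI PowI openin_subset[THEN subsetD]) simp
    show "id \<in> space ?R \<rightarrow> topspace (subtopology X A)"
      unfolding R by simp
    fix U assume "U \<in> {U. openin (subtopology X A) U}"
    then obtain W where W: "openin X W" "U = W \<inter> A"
      by (auto simp: openin_subtopology)
    have "W \<in> sets (borel_of X)"
      using W(1) by (simp add: sets_borel_of)
    moreover have "id -` U \<inter> space ?R = A \<inter> W"
      unfolding R W(2) using openin_subset[OF W(1)] by auto
    ultimately show "id -` U \<inter> space ?R \<in> sets ?R"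
      unfolding sets_restrict_space by simp
  qed
  from measurable_comp[OF this assms] show ?thesis
    by simp
qed

lemma second_countable_prod_topology:
  assumes "second_countable X" "second_countable Y"
  shows "second_countable (prod_topology X Y)"
proof -
  obtain A where A: "countable A" "\<forall>V\<in>A. openin X V"
    "\<forall>U x. openin X U \<and> x \<in> U \<longrightarrow> (\<exists>V\<in>A. x \<in> V \<and> V \<subseteq> U)"
    using assms(1) unfolding second_countable_def by (elim exE conjE) (rule that)
  obtain B where B: "countable B" "\<forall>V\<in>B. openin Y V"
    "\<forall>U x. openin Y U \<and> x \<in> U \<longrightarrow> (\<exists>V\<in>B. x \<in> V \<and> V \<subseteq> U)"
    using assms(2) unfolding second_countable_def by (elim exE conjE) (rule that)
  show ?thesis
    unfolding second_countable_def
  proof (intro exI[of _ "(\<lambda>(U, V). U \<times> V) ` (A \<times> B)"] conjI allI impI)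
    show "countable ((\<lambda>(U, V). U \<times> V) ` (A \<times> B))"
      using A(1) B(1) by (intro countable_image countable_SIGMA)
    show "\<forall>W\<in>(\<lambda>(U, V). U \<times> V) ` (A \<times> B). openin (prod_topology X Y) W"
      using A(2) B(2) by (auto simp: openin_prod_Times_iff)
    fix W z assume W: "openin (prod_topology X Y) W \<and> z \<in> W"
    have "\<exists>U V. openin X U \<and> openin Y V \<and> fst z \<in> U \<and> snd z \<in> V \<and> U \<times> V \<subseteq> W"
      using W by (cases z) (simp add: openin_prod_topology_alt)
    then obtain U V where U: "openin X U" "fst z \<in> U" and V: "openin Y V" "snd z \<in> V"
      and UV: "U \<times> V \<subseteq> W"
      by (elim exE conjE) (rule that)
    obtain U' where U': "U' \<in> A" "fst z \<in> U'" "U' \<subseteq> U"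
      using A(3)[rule_format, OF conjI, OF U] by (elim bexE conjE) (rule that)
    obtain V' where V': "V' \<in> B" "snd z \<in> V'" "V' \<subseteq> V"
      using B(3)[rule_format, OF conjI, OF V] by (elim bexE conjE) (rule that)
    have "U' \<times> V' \<in> (\<lambda>(U, V). U \<times> V) ` (A \<times> B)"
      using U'(1) V'(1) by (intro image_eqI[of _ _ "(U', V')"]) simp_all
    moreover have "z \<in> U' \<times> V'"
      using U'(2) V'(2) by (simp add: mem_Times_iff)
    moreover have "U' \<times> V' \<subseteq> W"
      using Sigma_mono[OF U'(3) V'(3)] UV by (rule subset_trans)
    ultimately show "\<exists>V\<in>(\<lambda>(U, V). U \<times> V) ` (A \<times> B). z \<in> V \<and> V \<subseteq> W"
      by (intro bexI conjI)
  qed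
qed

text \<open>Boxes of basic open sets form a base, and finiteness of \<open>I\<close> leaves only
  countably many of them.\<close>

lemma second_countable_product_topology:
  assumes I: "finite I" and X: "\<And>i. i \<in> I \<Longrightarrow> second_countable (X i)"
  shows "second_countable (product_topology X I)"
proof -
  have "\<forall>i\<in>I. \<exists>B. countable B \<and> (\<forall>V\<in>B. openin (X i) V) \<and>
      (\<forall>U x. openin (X i) U \<and> x \<in> U \<longrightarrow> (\<exists>V\<in>B. x \<in> V \<and> V \<subseteq> U))"
    using X unfolding second_countable_def by blast
  then obtain B where B: "\<And>i. i \<in> I \<Longrightarrow> countable (B i)"
    "\<And>i V. i \<in> I \<Longrightarrow> V \<in> B i \<Longrightarrow> openin (X i) V"
    "\<And>i U x. i \<in> I \<Longrightarrow> openin (X i) U \<Longrightarrow> x \<in> U \<Longrightarrow> \<exists>V\<in>B i. x \<in> V \<and> V \<subseteq> U"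
    by (metis (no_types, lifting))
  show ?thesis
    unfolding second_countable_def
  proof (intro exI[of _ "PiE I ` PiE I B"] conjI allI impI)
    show "countable (PiE I ` PiE I B)"
      using I B(1) by (intro countable_image countable_PiE)
    show "\<forall>W\<in>PiE I ` PiE I B. openin (product_topology X I) W"
      using I B(2) by (auto simp: openin_PiE_gen PiE_iff)
    fix W z assume W: "openin (product_topology X I) W \<and> z \<in> W"
    then obtain U where U: "\<And>i. i \<in> I \<Longrightarrow> openin (X i) (U i)" "z \<in> PiE I U" "PiE I U \<subseteq> W"
      unfolding openin_product_topology_alt by meson
    then have "\<forall>i\<in>I. \<exists>V. V \<in> B i \<and> z i \<in> V \<and> V \<subseteq> U i"
      using B(3) by (meson PiE_mem)
    then obtain V where V: "\<And>i. i \<in> I \<Longrightarrow> V i \<in> B i \<and> z i \<in> V i \<and> V i \<subseteq> U i"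
      by metis
    \<comment> \<open>\<open>V\<close> is restricted because the boxes are indexed by
      \<open>PiE I B\<close>, whose members are \<open>undefined\<close> outside
      \<open>I\<close>.\<close>
    have "PiE I (restrict V I) \<subseteq> PiE I U"
      by (rule PiE_mono) (simp add: V)
    then have "PiE I (restrict V I) \<subseteq> W"
      using U(3) by (rule subset_trans)
    moreover have "z \<in> PiE I (restrict V I)"
      using U(2) by (simp add: PiE_iff V)
    moreover have "PiE I (restrict V I) \<in> PiE I ` PiE I B"
      by (rule imageI) (simp add: PiE_iff extensional_def V)
    ultimately show "\<exists>V\<in>PiE I ` PiE I B. z \<in> V \<and> V \<subseteq> W"
      by (intro bexI conjI)
  qed
qed

lemma polish_top_prod_topology:
  "polish_top X \<Longrightarrow> polish_top Y \<Longrightarrow> polish_top (prod_topology X Y)"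
  by (simp add: polish_top_def completely_metrizable_space_prod_topology
      second_countable_prod_topology)

lemma polish_top_product_topology:
  assumes "finite I" "\<And>i. i \<in> I \<Longrightarrow> polish_top (X i)"
  shows "polish_top (product_topology X I)"
  using assms
  by (simp add: polish_top_def completely_metrizable_space_product_topology
      second_countable_product_topology countable_finite)

lemma polish_top_closed_subtopology:
  "polish_top X \<Longrightarrow> closedin X C \<Longrightarrow> polish_top (subtopology X C)"
  by (simp add: polish_top_def completely_metrizable_space_closedin second_countable_subtopology)

lemma polish_top_discrete_topology: "countable A \<Longrightarrow> polish_top (discrete_topology A)"
  by (simp add: polish_top_def completely_metrizable_space_discrete_topology
      second_countable_discrete_topology)

lemma polish_top_imp_Hausdorff_space: "polish_top X \<Longrightarrow> Hausdorff_space X"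
  by (simp add: polish_top_def completely_metrizable_imp_metrizable_space
      metrizable_imp_Hausdorff_space)

lemma continuous_map_binary_compose:
  assumes "continuous_map (prod_topology A B) C (\<lambda>(x, y). p x y)"
    and "continuous_map X A f" "continuous_map X B g"
  shows "continuous_map X C (\<lambda>x. p (f x) (g x))"
proof -
  have "continuous_map X (prod_topology A B) (\<lambda>x. (f x, g x))"
    using assms(2,3) by (simp add: continuous_map_paired)
  from continuous_map_compose[OF this assms(1)] show ?thesis
    by (simp add: o_def)
qed

section \<open>Topological groups and actions\<close>

lemma topological_group_imp_group: "topological_group G T \<Longrightarrow> group G"
  by (simp add: topological_group_def)

lemma topspace_topological_group: "topological_group G T \<Longrightarrow> topspace T = carrier G"
  by (simp add: topological_group_def)

lemma continuous_map_group_mult: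
  assumes "topological_group G T" "continuous_map X T f" "continuous_map X T g"
  shows "continuous_map X T (\<lambda>x. f x \<otimes>\<^bsub>G\<^esub> g x)"
  using assms unfolding topological_group_def by (blast intro: continuous_map_binary_compose)

lemma continuous_map_group_inv:
  assumes "topological_group G T" "continuous_map X T f"
  shows "continuous_map X T (\<lambda>x. inv\<^bsub>G\<^esub> (f x))"
  using assms continuous_map_compose[of X T f T "\<lambda>x. inv\<^bsub>G\<^esub> x"]
  unfolding topological_group_def by (simp add: o_def)

lemma topological_groupI:
  assumes "group G" "topspace T = carrier G"
    and "continuous_map (prod_topology T T) T (\<lambda>z. fst z \<otimes>\<^bsub>G\<^esub> snd z)"
    and "continuous_map T T (\<lambda>x. inv\<^bsub>G\<^esub> x)"
  shows "topological_group G T"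
  using assms by (simp add: topological_group_def case_prod_unfold)

lemma topological_group_subgroup:
  assumes T: "topological_group G T" and H: "subgroup H G"
  shows "topological_group (G\<lparr>carrier := H\<rparr>) (subtopology T H)"
proof (rule topological_groupI)
  interpret group G using T by (rule topological_group_imp_group)
  interpret subgroup H G by (rule H)
  let ?T = "subtopology T H"
  have top: "topspace T = carrier G"
    using T by (rule topspace_topological_group)
  show "group (G\<lparr>carrier := H\<rparr>)"
    by (rule subgroup_imp_group[OF H])
  have topH: "topspace ?T = H"
    using top subset by auto
  then show "topspace ?T = carrier (G\<lparr>carrier := H\<rparr>)"
    by simp
  have "continuous_map (prod_topology ?T ?T) T fst" "continuous_map (prod_topology ?T ?T) T snd"
    by (rule continuous_map_into_fulltopology, rule continuous_map_fst continuous_map_snd)+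
  then have "continuous_map (prod_topology ?T ?T) T (\<lambda>z. fst z \<otimes>\<^bsub>G\<^esub> snd z)"
    by (rule continuous_map_group_mult[OF T])
  then have "continuous_map (prod_topology ?T ?T) ?T (\<lambda>z. fst z \<otimes>\<^bsub>G\<^esub> snd z)"
    by (rule continuous_map_into_subtopology) (simp add: topH Pi_iff mem_Times_iff del: topspace_subtopology)
  then show "continuous_map (prod_topology ?T ?T) ?T
      (\<lambda>z. fst z \<otimes>\<^bsub>G\<lparr>carrier := H\<rparr>\<^esub> snd z)"
    by simp
  have "continuous_map ?T T (\<lambda>x. inv\<^bsub>G\<^esub> x)"
    by (rule continuous_map_group_inv[OF T]) (simp add: continuous_map_from_subtopology)
  then have "continuous_map ?T ?T (\<lambda>x. inv\<^bsub>G\<^esub> x)"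
    by (rule continuous_map_into_subtopology) (simp add: topH Pi_iff mem_Times_iff del: topspace_subtopology)
  \<comment> \<open>The inverse of the subgroup is known to agree with that of \<open>G\<close> only
    on \<open>H\<close>, hence the transfer along equality on the space.\<close>
  then show "continuous_map ?T ?T (\<lambda>x. inv\<^bsub>G\<lparr>carrier := H\<rparr>\<^esub> x)"
    by (rule continuous_map_eq) (simp add: m_inv_consistent[OF H] topH del: topspace_subtopology)
qed

text \<open>Unfolds homomorphisms into \<open>BijGroup\<close> to pointwise laws. Bijectivity is
  automatic, with the inverse element supplying the inverse map; extensionality has to be assumed
  because \<open>Bij\<close> contains only extensional maps.\<close>

lemma group_actionI:
  assumes G: "group G"
    and ext: "\<And>g. g \<in> carrier G \<Longrightarrow> \<phi> g \<in> extensional E"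
    and cl: "\<And>g x. g \<in> carrier G \<Longrightarrow> x \<in> E \<Longrightarrow> \<phi> g x \<in> E"
    and one: "\<And>x. x \<in> E \<Longrightarrow> \<phi> \<one>\<^bsub>G\<^esub> x = x"
    and mult: "\<And>g h x. g \<in> carrier G \<Longrightarrow> h \<in> carrier G \<Longrightarrow> x \<in> E \<Longrightarrow>
      \<phi> (g \<otimes>\<^bsub>G\<^esub> h) x = \<phi> g (\<phi> h x)"
  shows "group_action G E \<phi>"
proof -
  interpret group G by (rule G)
  have bij: "\<phi> g \<in> Bij E" if g: "g \<in> carrier G" for g
  proof -
    have "bij_betw (\<phi> g) E E"
      by (rule bij_betw_byWitness[where f' = "\<phi> (inv\<^bsub>G\<^esub> g)"])
        (use g in \<open>auto simp: cl one simp flip: mult\<close>)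
    then show ?thesis
      using ext[OF g] by (simp add: Bij_def)
  qed
  have "\<phi> (g \<otimes>\<^bsub>G\<^esub> h) = compose E (\<phi> g) (\<phi> h)" if "g \<in> carrier G" "h \<in> carrier G" for g h
  proof (rule extensionalityI)
    show "\<phi> (g \<otimes>\<^bsub>G\<^esub> h) \<in> extensional E" "compose E (\<phi> g) (\<phi> h) \<in> extensional E"
      using that ext by simp_all
  qed (use that in \<open>simp add: mult compose_eq\<close>)
  then have "\<phi> \<in> hom G (BijGroup E)"
    using bij by (auto simp: hom_def BijGroup_def)
  then show ?thesis
    unfolding group_action_def group_hom_def group_hom_axioms_def
    by (simp add: group_BijGroup)
qed

lemma (in group_action) orbit_eqrelD:
  assumes "(x, y) \<in> orbit_eqrel G X \<phi>" "topspace X = E"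
  shows "x \<in> E" "y \<in> E"
  using assms element_image by (auto simp: orbit_eqrel_def orbit_def)

lemma (in group_action) trans_orbit_eqrel:
  assumes E: "topspace X = E"
  shows "trans (orbit_eqrel G X \<phi>)"
proof (rule transI)
  fix x y z assume xy: "(x, y) \<in> orbit_eqrel G X \<phi>" and yz: "(y, z) \<in> orbit_eqrel G X \<phi>"
  then have "z \<in> orbit G \<phi> x"
    using orbit_trans[of x y z] orbit_eqrelD[OF xy E] orbit_eqrelD[OF yz E]
    by (auto simp: orbit_eqrel_def)
  then show "(x, z) \<in> orbit_eqrel G X \<phi>"
    using xy by (simp add: orbit_eqrel_def)
qed

text \<open>Orbit relations are transitive, so a path whose edges stay within orbits never leaves
  its orbit. The condition \<open>x \<in> E\<close> covers the path of length 0, which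
  \<open>rtrancl\<close> admits at every element of the type.\<close>

lemma (in group_action) rtrancl_subset_orbit_eqrel:
  assumes "topspace X = E" "R \<subseteq> orbit_eqrel G X \<phi>" "(x, y) \<in> R\<^sup>*" "x \<in> E"
  shows "(x, y) \<in> orbit_eqrel G X \<phi>"
  using assms(3)
proof induction
  case base
  then show ?case
    using assms orbit_refl by (simp add: orbit_eqrel_def)
next
  case (step y z)
  then show ?case
    using assms trans_orbit_eqrel[OF assms(1)] by (meson subsetD transD)
qed

lemma borel_action_restrict_hom:
  assumes act: "borel_action G T X \<phi>" and K: "topological_group K S"
    and hom: "f \<in> hom K G" and cont: "continuous_map S T f"
  shows "borel_action K S X (\<lambda>k. \<phi> (f k))"
proof -
  have "(\<lambda>k. \<phi> (f k)) \<in> hom K (BijGroup (topspace X))"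
    using act hom unfolding borel_action_def group_action_def group_hom_def group_hom_axioms_def
    by (auto simp: hom_def Pi_iff)
  then have "group_action K (topspace X) (\<lambda>k. \<phi> (f k))"
    using topological_group_imp_group[OF K]
    by (simp add: group_action_def group_hom_def group_hom_axioms_def group_BijGroup)
  moreover have "continuous_map (prod_topology S X) (prod_topology T X) (\<lambda>(k, x). (f k, x))"
    using cont by (subst continuous_map_prod_top) auto
  then have "(\<lambda>(g, x). \<phi> g x) \<circ> (\<lambda>(k, x). (f k, x))
      \<in> measurable (borel_of (prod_topology S X)) (borel_of X)"
    using act unfolding borel_action_def
    by (blast intro: measurable_comp continuous_map_measurable_borel_of)
  ultimately show ?thesis
    by (simp add: borel_action_def o_def case_prod_unfold)
qed

section \<open>Groups generated by graphic images\<close>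

text \<open>
  A type-independent stand-in for being the image of a graphic Polish group under a continuous
  homomorphism, so that groups over different types can generate a common group.
\<close>

definition graphic_in :: "('a, 'm) monoid_scheme \<Rightarrow> 'a topology \<Rightarrow> 'a set \<Rightarrow> bool" where
  "graphic_in G T H \<longleftrightarrow>
     (\<forall>(X :: nat set topology) \<phi>. polish_top X \<and> borel_action G T X \<phi> \<longrightarrow>
        borel_graphable X {(x, \<phi> h x) | x h. x \<in> topspace X \<and> h \<in> H})"

text \<open>Pulling an action of \<open>G\<close> back along \<open>f\<close> gives an action of
  \<open>K\<close>, whose orbit relation is exactly the set of pairs that \<open>graphic_in\<close>
  asks to graph.\<close>

lemma graphic_in_image:
  assumes K: "graphic_polish_group K S" and hom: "f \<in> hom K G" and cont: "continuous_map S T f"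
  shows "graphic_in G T (f ` carrier K)"
  unfolding graphic_in_def
proof (intro allI impI)
  fix X :: "nat set topology" and \<phi>
  assume X: "polish_top X \<and> borel_action G T X \<phi>"
  then have "borel_action K S X (\<lambda>k. \<phi> (f k))"
    using K hom cont borel_action_restrict_hom
    unfolding graphic_polish_group_def polish_group_def by blast
  then have "borel_graphable X (orbit_eqrel K X (\<lambda>k. \<phi> (f k)))"
    using K X by (simp add: graphic_polish_group_def)
  moreover have "orbit_eqrel K X (\<lambda>k. \<phi> (f k))
      = {(x, \<phi> h x) | x h. x \<in> topspace X \<and> h \<in> f ` carrier K}"
    by (auto simp: orbit_eqrel_def orbit_def)
  ultimately show "borel_graphable X {(x, \<phi> h x) | x h. x \<in> topspace X \<and> h \<in> f ` carrier K}"
    by simp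
qed

lemma graphic_in_subgroup:
  assumes "subgroup H G" "graphic_polish_group (G\<lparr>carrier := H\<rparr>) (subtopology T H)"
  shows "graphic_in G T H"
proof -
  have "(\<lambda>x. x) \<in> hom (G\<lparr>carrier := H\<rparr>) G"
    using assms(1) by (auto simp: hom_def subgroup.mem_carrier)
  from graphic_in_image[OF assms(2) this] show ?thesis
    by (simp add: continuous_map_from_subtopology)
qed

text \<open>Writing \<open>g\<close> as a word in the generators and their inverses turns a step
  from \<open>x\<close> to \<open>g x\<close> into a finite chain of steps inside the relations
  \<open>E i\<close>, each of which is a path in its own graph.\<close>

lemma graphic_polish_group_generated:
  assumes G: "polish_group G T" and I: "countable I"
    and sub: "\<And>i. i \<in> I \<Longrightarrow> H i \<subseteq> carrier G"
    and gr: "\<And>i. i \<in> I \<Longrightarrow> graphic_in G T (H i)"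
    and gen: "carrier G \<subseteq> generate G (\<Union>i\<in>I. H i)"
  shows "graphic_polish_group G T"
  unfolding graphic_polish_group_def
proof (intro conjI allI impI G)
  fix X :: "nat set topology" and \<phi>
  assume X: "polish_top X \<and> borel_action G T X \<phi>"
  interpret group_action G "topspace X" \<phi>
    using X by (simp add: borel_action_def)
  interpret group G
    using group_hom by (simp add: group_hom_def)
  define E where "E i = {(x, \<phi> h x) | x h. x \<in> topspace X \<and> h \<in> H i}" for i
  have "\<forall>i\<in>I. \<exists>R. borel_graph X R \<and> E i = connectedness_rel X R"
    using gr X by (auto simp: graphic_in_def borel_graphable_def E_def)
  then obtain R where R: "\<And>i. i \<in> I \<Longrightarrow> borel_graph X (R i)"
    and ER: "\<And>i. i \<in> I \<Longrightarrow> E i = connectedness_rel X (R i)"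
    by metis
  \<comment> \<open>An edge is a path of length 1, and Borel sets of the square consist of pairs of
    points of the space.\<close>
  have Rsub: "R i \<subseteq> E i" if "i \<in> I" for i
    using R[OF that] sets.sets_into_space[of "R i" "borel_of (prod_topology X X)"]
    by (auto simp: ER[OF that] connectedness_rel_def borel_graph_def)
  define S where "S = (\<Union>i\<in>I. R i)"
  have sym: "sym S"
    using R by (auto simp: S_def borel_graph_def sym_def)
  have "borel_graph X S"
    using R I sym by (auto simp: S_def borel_graph_def irrefl_def intro!: sets.countable_UN')
  moreover have "orbit_eqrel G X \<phi> = connectedness_rel X S"
  proof (intro equalityI subrelI)
    have ES: "E i \<subseteq> S\<^sup>*" if "i \<in> I" for i
      using that ER[OF that] rtrancl_mono[of "R i" S] by (auto simp: S_def connectedness_rel_def)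
    \<comment> \<open>The start point stays arbitrary: in a product \<open>h1 h2\<close> the path
      for \<open>h1\<close> begins at \<open>h2 x\<close>.\<close>
    have path: "(x, \<phi> g x) \<in> S\<^sup>*" if "g \<in> generate G (\<Union>i\<in>I. H i)" "x \<in> topspace X" for g x
      using that
    proof (induction arbitrary: x)
      case one
      then show ?case
        using id_eq_one by (metis restrict_apply' rtrancl.rtrancl_refl)
    next
      case (incl h)
      then show ?case
        using ES by (auto simp: E_def)
    next
      case (inv h)
      then obtain i where i: "i \<in> I" "h \<in> H i" by blast
      then have h: "h \<in> carrier G" using sub by blast
      \<comment> \<open>\<open>H i\<close> is only a set of generators and may lack the inverse of
        \<open>h\<close>. The step by \<open>h\<close> from \<open>inv h x\<close> to
        \<open>x\<close> is available instead, and symmetry of \<open>S\<close> reverses its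
        path.\<close>
      have "(\<phi> (inv\<^bsub>G\<^esub> h) x, \<phi> h (\<phi> (inv\<^bsub>G\<^esub> h) x)) \<in> E i"
        using i element_image[OF inv_closed[OF h] inv.prems refl] by (auto simp: E_def)
      moreover have "\<phi> h (\<phi> (inv\<^bsub>G\<^esub> h) x) = x"
        using orbit_sym_aux[OF inv_closed[OF h] inv.prems refl] h by simp
      ultimately show ?case
        using ES[OF i(1)] sym_rtrancl[OF sym] by (auto dest: symD)
    next
      case (eng h1 h2)
      have "(\<Union>i\<in>I. H i) \<subseteq> carrier G"
        using sub by (rule UN_least)
      then have h: "h1 \<in> carrier G" "h2 \<in> carrier G"
        using eng.hyps by (simp_all add: generate_in_carrier)
      have "(\<phi> h2 x, \<phi> h1 (\<phi> h2 x)) \<in> S\<^sup>*"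
        using element_image[OF h(2) eng.prems refl] by (rule eng.IH(1))
      with eng.IH(2)[OF eng.prems] have "(x, \<phi> h1 (\<phi> h2 x)) \<in> S\<^sup>*"
        by (rule rtrancl_trans)
      then show ?case
        using eng.prems h by (simp add: composition_rule)
    qed
    fix x y
    show "(x, y) \<in> connectedness_rel X S" if xy: "(x, y) \<in> orbit_eqrel G X \<phi>"
      using that orbit_eqrelD[OF xy] path gen
      by (auto simp: connectedness_rel_def orbit_eqrel_def orbit_def)
    show "(x, y) \<in> orbit_eqrel G X \<phi>" if "(x, y) \<in> connectedness_rel X S"
    proof (rule rtrancl_subset_orbit_eqrel[of X S])
      show "S \<subseteq> orbit_eqrel G X \<phi>"
        using Rsub sub by (fastforce simp: S_def E_def orbit_eqrel_def orbit_def)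
    qed (use that in \<open>auto simp: connectedness_rel_def\<close>)
  qed
  ultimately show "borel_graphable X (orbit_eqrel G X \<phi>)"
    by (auto simp: borel_graphable_def)
qed

section \<open>Internal products, countable unions and quotients\<close>

lemma graphic_polish_group_internal_product:
  assumes G: "polish_group G T"
    and H: "\<And>H. H \<in> set Hs \<Longrightarrow> subgroup H G"
      "\<And>H. H \<in> set Hs \<Longrightarrow> graphic_polish_group (G\<lparr>carrier := H\<rparr>) (subtopology T H)"
    and prod: "carrier G = foldr (\<lambda>H K. H <#>\<^bsub>G\<^esub> K) Hs {\<one>\<^bsub>G\<^esub>}"
  shows "graphic_polish_group G T"
proof (rule graphic_polish_group_generated[OF G, of "set Hs" "\<lambda>H. H"])
  \<comment> \<open>The list \<open>Ks\<close> shrinks in the induction while the generating family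
    stays that of \<open>Hs\<close>.\<close>
  have "foldr (\<lambda>H K. H <#>\<^bsub>G\<^esub> K) Ks {\<one>\<^bsub>G\<^esub>} \<subseteq> generate G (\<Union>H\<in>set Hs. H)"
    if "set Ks \<subseteq> set Hs" for Ks
    using that
  proof (induction Ks)
    case Nil
    then show ?case
      by (simp add: generate.one)
  next
    case (Cons K Ks)
    then have "K \<subseteq> generate G (\<Union>H\<in>set Hs. H)"
      by (auto intro!: generate.incl)
    then show ?case
      using Cons by (auto simp: set_mult_def intro!: generate.eng)
  qed
  then show "carrier G \<subseteq> generate G (\<Union>H\<in>set Hs. H)"
    unfolding prod by simp
  show "countable (set Hs)"
    by (simp add: countable_finite)
  show "H \<subseteq> carrier G" "graphic_in G T H" if "H \<in> set Hs" for H
    using H[OF that] by (simp_all add: subgroup.subset graphic_in_subgroup)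
qed

lemma graphic_polish_group_countable_Union:
  assumes G: "polish_group G T" and I: "countable I"
    and H: "\<And>i. i \<in> I \<Longrightarrow> subgroup (H i) G"
      "\<And>i. i \<in> I \<Longrightarrow> graphic_polish_group (G\<lparr>carrier := H i\<rparr>) (subtopology T (H i))"
    and un: "carrier G = (\<Union>i\<in>I. H i)"
  shows "graphic_polish_group G T"
proof (rule graphic_polish_group_generated[OF G I])
  show "carrier G \<subseteq> generate G (\<Union>i\<in>I. H i)"
    unfolding un by (rule subsetI) (rule generate.incl)
  show "H i \<subseteq> carrier G" "graphic_in G T (H i)" if "i \<in> I" for i
    using H[OF that] by (simp_all add: subgroup.subset graphic_in_subgroup)
qed

text \<open>By surjectivity, an action of \<open>G\<close> and its pullback to \<open>K\<close> have
  the same orbits. This is the generation lemma with a single generating set, the whole of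
  \<open>G\<close>.\<close>

lemma graphic_polish_group_hom_image:
  assumes K: "graphic_polish_group K S" and G: "polish_group G T"
    and hom: "f \<in> hom K G" and cont: "continuous_map S T f" and surj: "f ` carrier K = carrier G"
  shows "graphic_polish_group G T"
proof (rule graphic_polish_group_generated[OF G, of "{()}" "\<lambda>_. carrier G"])
  show "graphic_in G T (carrier G)"
    using graphic_in_image[OF K hom cont] by (simp add: surj)
  show "carrier G \<subseteq> generate G (\<Union>i\<in>{()}. carrier G)"
    by (simp add: subsetI generate.incl)
qed simp_all

text \<open>The quotient is described up to isomorphism: \<open>f\<close> identifies the algebraic
  quotient with \<open>Q\<close>, and the composite with the coset map must be a topological
  quotient map, so that \<open>TQ\<close> is the quotient topology. That composite is a continuous
  surjective homomorphism.\<close>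

lemma graphic_polish_group_quotient:
  assumes G: "graphic_polish_group G T" and N: "N \<lhd> G" and Q: "polish_group Q TQ"
    and f: "f \<in> iso (G Mod N) Q" and quot: "quotient_map T TQ (\<lambda>g. f (N #>\<^bsub>G\<^esub> g))"
  shows "graphic_polish_group Q TQ"
proof (rule graphic_polish_group_hom_image[OF G Q])
  have "f \<in> hom (G Mod N) Q"
    using f by (simp add: iso_def)
  from hom_compose[OF normal.r_coset_hom_Mod[OF N] this]
  show "(\<lambda>g. f (N #>\<^bsub>G\<^esub> g)) \<in> hom G Q"
    by (simp add: o_def)
  show "continuous_map T TQ (\<lambda>g. f (N #>\<^bsub>G\<^esub> g))"
    using quot by (rule quotient_imp_continuous_map)
  show "(\<lambda>g. f (N #>\<^bsub>G\<^esub> g)) ` carrier G = carrier Q"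
    using quotient_imp_surjective_map[OF quot] G Q topspace_topological_group
    by (metis graphic_polish_group_def polish_group_def)
qed

section \<open>Direct and semidirect products\<close>

lemma topological_group_product_group:
  assumes T: "\<And>i. i \<in> I \<Longrightarrow> topological_group (G i) (T i)"
  shows "topological_group (product_group I G) (product_topology T I)"
proof (rule topological_groupI)
  have grp: "\<And>i. i \<in> I \<Longrightarrow> group (G i)"
    using T topological_group_imp_group by blast
  have top: "\<And>i. i \<in> I \<Longrightarrow> topspace (T i) = carrier (G i)"
    using T topspace_topological_group by blast
  let ?P = "product_topology T I"
  show "group (product_group I G)"
    using grp by (rule product_group)
  show topP: "topspace ?P = carrier (product_group I G)"
    using top by (simp cong: PiE_cong)
  have "continuous_map (prod_topology ?P ?P) (T i) (\<lambda>z. fst z i \<otimes>\<^bsub>G i\<^esub> snd z i)" if i: "i \<in> I" for i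
  proof (rule continuous_map_group_mult[OF T[OF i]])
    have proj: "continuous_map ?P (T i) (\<lambda>x. x i)"
      using i by (rule continuous_map_product_projection)
    show "continuous_map (prod_topology ?P ?P) (T i) (\<lambda>z. fst z i)"
      using continuous_map_compose[OF continuous_map_fst proj] by (simp add: o_def)
    show "continuous_map (prod_topology ?P ?P) (T i) (\<lambda>z. snd z i)"
      using continuous_map_compose[OF continuous_map_snd proj] by (simp add: o_def)
  qed
  then show "continuous_map (prod_topology ?P ?P) ?P (\<lambda>z. fst z \<otimes>\<^bsub>product_group I G\<^esub> snd z)"
    by (auto simp: continuous_map_componentwise)
  have "continuous_map ?P (T i) (\<lambda>x. inv\<^bsub>G i\<^esub> (x i))" if i: "i \<in> I" for i
    using continuous_map_product_projection[OF i] by (rule continuous_map_group_inv[OF T[OF i]])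
  then have "continuous_map ?P ?P (\<lambda>x. \<lambda>i\<in>I. inv\<^bsub>G i\<^esub> (x i))"
    by (auto simp: continuous_map_componentwise)
  then show "continuous_map ?P ?P (\<lambda>x. inv\<^bsub>product_group I G\<^esub> x)"
    by (rule continuous_map_eq) (simp add: topP grp del: topspace_product_topology)
qed

lemma polish_group_product_group:
  assumes "finite I" "\<And>i. i \<in> I \<Longrightarrow> polish_group (G i) (T i)"
  shows "polish_group (product_group I G) (product_topology T I)"
  using assms by (simp add: polish_group_def topological_group_product_group
      polish_top_product_topology)

lemma graphic_polish_group_product_group:
  assumes I: "finite I" and gr: "\<And>i. i \<in> I \<Longrightarrow> graphic_polish_group (G i) (T i)"
  shows "graphic_polish_group (product_group I G) (product_topology T I)"
proof -
  have pol: "\<And>i. i \<in> I \<Longrightarrow> polish_group (G i) (T i)"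
    using gr by (simp add: graphic_polish_group_def)
  have top: "\<And>i. i \<in> I \<Longrightarrow> topspace (T i) = carrier (G i)"
    and grp: "\<And>i. i \<in> I \<Longrightarrow> group (G i)"
    using pol topspace_topological_group topological_group_imp_group
    unfolding polish_group_def by blast+
  have one: "\<And>i. i \<in> I \<Longrightarrow> \<one>\<^bsub>G i\<^esub> \<in> carrier (G i)"
    using grp by (simp add: group.is_monoid)
  \<comment> \<open>The embedding of the \<open>i\<close>-th factor, with the unit in all other
    coordinates.\<close>
  define e where "e i a = (\<lambda>j\<in>I. if j = i then a else \<one>\<^bsub>G j\<^esub>)" for i a
  have ecar: "e i a \<in> carrier (product_group I G)" if "i \<in> I" "a \<in> carrier (G i)" for i a
    using that one by (simp add: e_def PiE_iff extensional_def)
  have hom: "e i \<in> hom (G i) (product_group I G)" if i: "i \<in> I" for i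
  proof (rule homI)
    show "e i a \<in> carrier (product_group I G)" if "a \<in> carrier (G i)" for a
      using i that by (rule ecar)
    show "e i (a \<otimes>\<^bsub>G i\<^esub> b) = e i a \<otimes>\<^bsub>product_group I G\<^esub> e i b" for a b
      using grp by (simp add: e_def fun_eq_iff group.is_monoid monoid.l_one)
  qed
  have cont: "continuous_map (T i) (product_topology T I) (e i)" if i: "i \<in> I" for i
  proof -
    have "continuous_map (T i) (T j) (\<lambda>a. if j = i then a else \<one>\<^bsub>G j\<^esub>)" if "j \<in> I" for j
      using that one top by (cases "j = i") simp_all
    then show ?thesis
      by (auto simp: continuous_map_componentwise e_def)
  qed
  let ?A = "\<Union>i\<in>I. e i ` carrier (G i)"
  \<comment> \<open>Induction on the set \<open>J\<close> of coordinates already filled in, the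
    others being the unit; inserting \<open>i\<close> multiplies by an element of the
    \<open>i\<close>-th factor. For \<open>J = I\<close> the element is \<open>x\<close>
    itself.\<close>
  have gen: "(\<lambda>j\<in>I. if j \<in> J then x j else \<one>\<^bsub>G j\<^esub>) \<in> generate (product_group I G) ?A"
    if "finite J" "J \<subseteq> I" "x \<in> carrier (product_group I G)" for J x
    using that
  proof induction
    case empty
    then show ?case
      using generate.one[of "product_group I G" ?A] by (simp add: restrict_def)
  next
    case (insert i J)
    have xc: "\<And>j. j \<in> I \<Longrightarrow> x j \<in> carrier (G j)"
      using insert.prems by (auto simp: PiE_iff)
    have "J \<subseteq> I" and "e i (x i) \<in> ?A"
      using insert.prems xc by auto
    then have "e i (x i) \<otimes>\<^bsub>product_group I G\<^esub> (\<lambda>j\<in>I. if j \<in> J then x j else \<one>\<^bsub>G j\<^esub>)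
        \<in> generate (product_group I G) ?A"
      using insert.IH insert.prems by (intro generate.eng[OF generate.incl])
    moreover have "e i (x i) \<otimes>\<^bsub>product_group I G\<^esub> (\<lambda>j\<in>I. if j \<in> J then x j else \<one>\<^bsub>G j\<^esub>)
        = (\<lambda>j\<in>I. if j \<in> insert i J then x j else \<one>\<^bsub>G j\<^esub>)"
      using insert.hyps xc grp
      by (simp add: e_def fun_eq_iff group.is_monoid monoid.l_one monoid.r_one)
    ultimately show ?case
      by (simp only:)
  qed
  show ?thesis
  proof (rule graphic_polish_group_generated)
    show "polish_group (product_group I G) (product_topology T I)"
      using I pol by (rule polish_group_product_group)
    show "countable I"
      using I by (rule countable_finite)
    show "e i ` carrier (G i) \<subseteq> carrier (product_group I G)" if "i \<in> I" for i
      using ecar that by blast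
    show "graphic_in (product_group I G) (product_topology T I) (e i ` carrier (G i))"
      if i: "i \<in> I" for i
      using gr[OF i] hom[OF i] cont[OF i] by (rule graphic_in_image)
    show "carrier (product_group I G) \<subseteq> generate (product_group I G) ?A"
    proof
      fix x assume x: "x \<in> carrier (product_group I G)"
      then have "(\<lambda>j\<in>I. if j \<in> I then x j else \<one>\<^bsub>G j\<^esub>) = x"
        by (auto simp: PiE_iff extensional_def fun_eq_iff)
      with gen[OF I subset_refl x] show "x \<in> generate (product_group I G) ?A"
        by (simp only:)
    qed
  qed
qed

section \<open>Semidirect products\<close>

lemma carrier_semidirect_product [simp]:
  "carrier (semidirect_product N H \<alpha>) = carrier N \<times> carrier H"
  by (simp add: semidirect_product_def)

lemma one_semidirect_product [simp]: "\<one>\<^bsub>semidirect_product N H \<alpha>\<^esub> = (\<one>\<^bsub>N\<^esub>, \<one>\<^bsub>H\<^esub>)"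
  by (simp add: semidirect_product_def)

lemma mult_semidirect_product [simp]:
  "(n, h) \<otimes>\<^bsub>semidirect_product N H \<alpha>\<^esub> (n', h') = (n \<otimes>\<^bsub>N\<^esub> \<alpha> h n', h \<otimes>\<^bsub>H\<^esub> h')"
  by (simp add: semidirect_product_def)

text \<open>Automorphisms are among the bijections of the carrier, with the same composition, so the
  laws of group actions apply to \<alpha>; the homomorphism property is kept as a second
  fact.\<close>

lemma group_action_AutoGroup:
  assumes H: "group H" and \<alpha>: "\<alpha> \<in> hom H (AutoGroup N)"
  shows "group_action H (carrier N) \<alpha>"
    and "\<And>h n n'. h \<in> carrier H \<Longrightarrow> n \<in> carrier N \<Longrightarrow> n' \<in> carrier N \<Longrightarrow>
      \<alpha> h (n \<otimes>\<^bsub>N\<^esub> n') = \<alpha> h n \<otimes>\<^bsub>N\<^esub> \<alpha> h n'"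
proof -
  have "\<alpha> \<in> hom H (BijGroup (carrier N))"
    using \<alpha> by (auto simp: hom_def AutoGroup_def auto_def BijGroup_def Pi_iff)
  then show "group_action H (carrier N) \<alpha>"
    using H by (simp add: group_action_def group_hom_def group_hom_axioms_def group_BijGroup)
  fix h n n' assume "h \<in> carrier H" "n \<in> carrier N" "n' \<in> carrier N"
  moreover from this have "\<alpha> h \<in> hom N N"
    using \<alpha> by (auto simp: hom_def AutoGroup_def auto_def Pi_iff)
  ultimately show "\<alpha> h (n \<otimes>\<^bsub>N\<^esub> n') = \<alpha> h n \<otimes>\<^bsub>N\<^esub> \<alpha> h n'"
    by (simp add: hom_mult)
qed

lemma semidirect_product_group:
  assumes N: "group N" and H: "group H" and \<alpha>: "\<alpha> \<in> hom H (AutoGroup N)"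
  shows "group (semidirect_product N H \<alpha>)" (is ?group)
    and "\<And>n h. n \<in> carrier N \<Longrightarrow> h \<in> carrier H \<Longrightarrow>
      inv\<^bsub>semidirect_product N H \<alpha>\<^esub> (n, h) = (\<alpha> (inv\<^bsub>H\<^esub> h) (inv\<^bsub>N\<^esub> n), inv\<^bsub>H\<^esub> h)"
proof -
  interpret N: group N by (rule N)
  interpret H: group H by (rule H)
  interpret A: group_action H "carrier N" \<alpha>
    using H \<alpha> by (rule group_action_AutoGroup)
  note hom = group_action_AutoGroup(2)[OF H \<alpha>]
  have cl: "\<alpha> h n \<in> carrier N" if "h \<in> carrier H" "n \<in> carrier N" for h n
    using that A.element_image by blast
  have one: "\<alpha> \<one>\<^bsub>H\<^esub> n = n" if "n \<in> carrier N" for n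
    using that A.id_eq_one by (metis restrict_apply')
  \<comment> \<open>The element \<alpha> h 1 equals its own square, and the unit is the only
    idempotent of a group.\<close>
  have unit: "\<alpha> h \<one>\<^bsub>N\<^esub> = \<one>\<^bsub>N\<^esub>" if "h \<in> carrier H" for h
    using hom[OF that N.one_closed N.one_closed] cl[OF that N.one_closed] by simp
  \<comment> \<open>Solving (n', h') (n, h) = 1 forces h' to be the inverse of h, and then n' is the
    image under \<alpha> h' of the inverse of n.\<close>
  have linv: "(\<alpha> (inv\<^bsub>H\<^esub> h) (inv\<^bsub>N\<^esub> n), inv\<^bsub>H\<^esub> h) \<otimes>\<^bsub>semidirect_product N H \<alpha>\<^esub> (n, h)
      = \<one>\<^bsub>semidirect_product N H \<alpha>\<^esub>" if "n \<in> carrier N" "h \<in> carrier H" for n h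
    using that hom[of "inv\<^bsub>H\<^esub> h" "inv\<^bsub>N\<^esub> n" n] unit by simp
  show grp: ?group
  proof (rule groupI)
    fix x y z
    assume x: "x \<in> carrier (semidirect_product N H \<alpha>)"
      and y: "y \<in> carrier (semidirect_product N H \<alpha>)"
      and z: "z \<in> carrier (semidirect_product N H \<alpha>)"
    show "x \<otimes>\<^bsub>semidirect_product N H \<alpha>\<^esub> y \<in> carrier (semidirect_product N H \<alpha>)"
      using x y cl by (cases x; cases y) simp
    show "x \<otimes>\<^bsub>semidirect_product N H \<alpha>\<^esub> y \<otimes>\<^bsub>semidirect_product N H \<alpha>\<^esub> z
        = x \<otimes>\<^bsub>semidirect_product N H \<alpha>\<^esub> (y \<otimes>\<^bsub>semidirect_product N H \<alpha>\<^esub> z)"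
      using x y z cl by (cases x; cases y; cases z)
        (simp add: hom A.composition_rule N.m_assoc H.m_assoc)
  next
    fix x assume x: "x \<in> carrier (semidirect_product N H \<alpha>)"
    show "\<one>\<^bsub>semidirect_product N H \<alpha>\<^esub> \<otimes>\<^bsub>semidirect_product N H \<alpha>\<^esub> x = x"
      using x one by (cases x) simp
    obtain n h where xnh: "x = (n, h)" "n \<in> carrier N" "h \<in> carrier H"
      using x by auto
    show "\<exists>y\<in>carrier (semidirect_product N H \<alpha>).
        y \<otimes>\<^bsub>semidirect_product N H \<alpha>\<^esub> x = \<one>\<^bsub>semidirect_product N H \<alpha>\<^esub>"
      unfolding xnh(1) using linv[OF xnh(2,3)] xnh(2,3) cl
      by (intro bexI[of _ "(\<alpha> (inv\<^bsub>H\<^esub> h) (inv\<^bsub>N\<^esub> n), inv\<^bsub>H\<^esub> h)"]) simp_all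
  qed simp_all
  fix n h assume nh: "n \<in> carrier N" "h \<in> carrier H"
  show "inv\<^bsub>semidirect_product N H \<alpha>\<^esub> (n, h) = (\<alpha> (inv\<^bsub>H\<^esub> h) (inv\<^bsub>N\<^esub> n), inv\<^bsub>H\<^esub> h)"
    by (rule group.inv_equality[OF grp linv[OF nh]]) (use nh cl in simp_all)
qed

text \<open>Joint continuity of \<alpha> is used twice: multiplication contains the twisted factor
  \<alpha> h n', and in the inverse both arguments of \<alpha> vary.\<close>

lemma topological_group_semidirect_product:
  assumes N: "topological_group N TN" and H: "topological_group H TH"
    and \<alpha>: "\<alpha> \<in> hom H (AutoGroup N)"
    and cont: "continuous_map (prod_topology TH TN) TN (\<lambda>(h, n). \<alpha> h n)"
  shows "topological_group (semidirect_product N H \<alpha>) (prod_topology TN TH)"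
proof (rule topological_groupI)
  let ?P = "prod_topology TN TH"
  note grp = topological_group_imp_group[OF N] topological_group_imp_group[OF H]
  note top = topspace_topological_group[OF N] topspace_topological_group[OF H]
  show "group (semidirect_product N H \<alpha>)"
    using grp \<alpha> by (rule semidirect_product_group)
  show "topspace ?P = carrier (semidirect_product N H \<alpha>)"
    using top by simp
  have fst2: "continuous_map (prod_topology ?P ?P) TN (\<lambda>z. fst (fst z))"
    "continuous_map (prod_topology ?P ?P) TN (\<lambda>z. fst (snd z))"
    and snd2: "continuous_map (prod_topology ?P ?P) TH (\<lambda>z. snd (fst z))"
    "continuous_map (prod_topology ?P ?P) TH (\<lambda>z. snd (snd z))"
    using continuous_map_compose[OF continuous_map_fst[of ?P ?P] continuous_map_fst]
      continuous_map_compose[OF continuous_map_snd[of ?P ?P] continuous_map_fst]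
      continuous_map_compose[OF continuous_map_fst[of ?P ?P] continuous_map_snd]
      continuous_map_compose[OF continuous_map_snd[of ?P ?P] continuous_map_snd]
    by (simp_all add: o_def)
  have "continuous_map (prod_topology ?P ?P) ?P
      (\<lambda>z. (fst (fst z) \<otimes>\<^bsub>N\<^esub> \<alpha> (snd (fst z)) (fst (snd z)), snd (fst z) \<otimes>\<^bsub>H\<^esub> snd (snd z)))"
    unfolding continuous_map_paired
    using fst2 snd2
    by (intro conjI continuous_map_group_mult[OF N] continuous_map_group_mult[OF H]
        continuous_map_binary_compose[OF cont])
  then show "continuous_map (prod_topology ?P ?P) ?P
      (\<lambda>z. fst z \<otimes>\<^bsub>semidirect_product N H \<alpha>\<^esub> snd z)"
    by (simp add: semidirect_product_def case_prod_unfold)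
  have "continuous_map ?P ?P
      (\<lambda>z. (\<alpha> (inv\<^bsub>H\<^esub> (snd z)) (inv\<^bsub>N\<^esub> (fst z)), inv\<^bsub>H\<^esub> (snd z)))"
    unfolding continuous_map_paired
    by (intro conjI continuous_map_group_inv[OF N] continuous_map_group_inv[OF H]
        continuous_map_binary_compose[OF cont] continuous_map_fst continuous_map_snd)
  then show "continuous_map ?P ?P (\<lambda>z. inv\<^bsub>semidirect_product N H \<alpha>\<^esub> z)"
    by (rule continuous_map_eq)
      (auto simp: top semidirect_product_group(2)[OF grp \<alpha>])
qed

lemma graphic_polish_group_semidirect_product:
  assumes N: "graphic_polish_group N TN" and H: "graphic_polish_group H TH"
    and \<alpha>: "\<alpha> \<in> hom H (AutoGroup N)"
    and cont: "continuous_map (prod_topology TH TN) TN (\<lambda>(h, n). \<alpha> h n)"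
  shows "graphic_polish_group (semidirect_product N H \<alpha>) (prod_topology TN TH)"
proof -
  let ?G = "semidirect_product N H \<alpha>" and ?T = "prod_topology TN TH"
  have pol: "polish_group N TN" "polish_group H TH"
    using N H by (simp_all add: graphic_polish_group_def)
  then have tg: "topological_group N TN" "topological_group H TH"
    by (simp_all add: polish_group_def)
  interpret N: group N using tg(1) by (rule topological_group_imp_group)
  interpret H: group H using tg(2) by (rule topological_group_imp_group)
  interpret A: group_action H "carrier N" \<alpha>
    using H.is_group \<alpha> by (rule group_action_AutoGroup)
  have top: "topspace TN = carrier N" "topspace TH = carrier H"
    using tg topspace_topological_group by blast+
  have one: "\<alpha> \<one>\<^bsub>H\<^esub> n = n" if "n \<in> carrier N" for n
    using that A.id_eq_one by (metis restrict_apply')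
  have unit: "\<alpha> h \<one>\<^bsub>N\<^esub> = \<one>\<^bsub>N\<^esub>" if h: "h \<in> carrier H" for h
  proof -
    have "\<alpha> h \<one>\<^bsub>N\<^esub> \<in> carrier N"
      using A.element_image[OF h N.one_closed refl] .
    then show ?thesis
      using group_action_AutoGroup(2)[OF H.is_group \<alpha> h N.one_closed N.one_closed] by simp
  qed
  \<comment> \<open>The two factors are indexed by \<open>bool\<close> to form one family of
    generating sets inside the product type.\<close>
  let ?H = "\<lambda>b. if b then (\<lambda>n. (n, \<one>\<^bsub>H\<^esub>)) ` carrier N else (\<lambda>h. (\<one>\<^bsub>N\<^esub>, h)) ` carrier H"
  have "graphic_in ?G ?T ((\<lambda>n. (n, \<one>\<^bsub>H\<^esub>)) ` carrier N)"
  proof (rule graphic_in_image[OF N])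
    show "(\<lambda>n. (n, \<one>\<^bsub>H\<^esub>)) \<in> hom N ?G"
      by (rule homI) (simp_all add: one)
    show "continuous_map TN ?T (\<lambda>n. (n, \<one>\<^bsub>H\<^esub>))"
      by (simp add: continuous_map_paired top)
  qed
  moreover have "graphic_in ?G ?T ((\<lambda>h. (\<one>\<^bsub>N\<^esub>, h)) ` carrier H)"
  proof (rule graphic_in_image[OF H])
    show "(\<lambda>h. (\<one>\<^bsub>N\<^esub>, h)) \<in> hom H ?G"
      by (rule homI) (simp_all add: unit)
    show "continuous_map TH ?T (\<lambda>h. (\<one>\<^bsub>N\<^esub>, h))"
      by (simp add: continuous_map_paired top)
  qed
  ultimately have gr: "graphic_in ?G ?T (?H b)" for b
    by simp
  show ?thesis
  proof (rule graphic_polish_group_generated)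
    show "polish_group ?G ?T"
      using pol topological_group_semidirect_product[OF tg \<alpha> cont]
      by (simp add: polish_group_def polish_top_prod_topology)
    show "countable (UNIV :: bool set)"
      by simp
    show "graphic_in ?G ?T (?H b)" for b
      by (rule gr)
    show "?H b \<subseteq> carrier ?G" for b
      by auto
    show "carrier ?G \<subseteq> generate ?G (\<Union>b\<in>UNIV. ?H b)"
    proof
      fix x assume "x \<in> carrier ?G"
      then obtain n h where x: "x = (n, h)" and nh: "n \<in> carrier N" "h \<in> carrier H"
        by auto
      have "(n, \<one>\<^bsub>H\<^esub>) \<in> (\<Union>b\<in>UNIV. ?H b)" "(\<one>\<^bsub>N\<^esub>, h) \<in> (\<Union>b\<in>UNIV. ?H b)"
        using nh by (auto simp: UNIV_bool)
      \<comment> \<open>Every element factors as (n, 1) (1, h), because \<alpha> at the unit fixes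
        the unit of \<open>N\<close>.\<close>
      then have "(n, \<one>\<^bsub>H\<^esub>) \<otimes>\<^bsub>?G\<^esub> (\<one>\<^bsub>N\<^esub>, h) \<in> generate ?G (\<Union>b\<in>UNIV. ?H b)"
        by (intro generate.eng generate.incl)
      then show "x \<in> generate ?G (\<Union>b\<in>UNIV. ?H b)"
        using nh by (simp add: x one)
    qed
  qed
qed

section \<open>Closed subgroups of countable index\<close>

text \<open>Turns an equality of cosets into membership in \<open>D\<close>, which is a closed
  condition when \<open>D\<close> is closed.\<close>

lemma (in group) rcos_eq_iff:
  assumes D: "subgroup D G" and a: "a \<in> carrier G" and b: "b \<in> carrier G"
  shows "D #> a = D #> b \<longleftrightarrow> b \<otimes> inv a \<in> D"
proof
  assume "D #> a = D #> b"
  then have "b \<in> D #> a"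
    using rcos_self[OF b D] by simp
  then obtain d where "d \<in> D" "b = d \<otimes> a"
    by (auto simp: r_coset_def)
  then show "b \<otimes> inv a \<in> D"
    using D a by (simp add: m_assoc subgroup.mem_carrier)
next
  assume d: "b \<otimes> inv a \<in> D"
  have "(b \<otimes> inv a) \<otimes> a \<in> D #> a"
    using d a D by (intro rcosI) (simp_all add: subgroup.subset)
  then have "b \<in> D #> a"
    using a b by (simp add: m_assoc)
  then show "D #> a = D #> b"
    using a D by (rule repr_independence)
qed

text \<open>
  The action of \<open>G\<close> induced from an action of \<open>D\<close>: with coset representatives \<open>s C\<close>, the element
  \<open>g\<close> maps \<open>(x, C)\<close> to \<open>(s (C g\<^sup>-\<^sup>1) g (s C)\<^sup>-\<^sup>1 x, C g\<^sup>-\<^sup>1)\<close>. As the cocycle takes all values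
  in \<open>D\<close> for every prescribed pair of cosets, the orbit relation ignores the coset coordinate.
\<close>

lemma induced_borel_action:
  assumes G: "topological_group G T" and D: "subgroup D G" and closed: "closedin T D"
    and count: "countable (rcosets\<^bsub>G\<^esub> D)"
    and act: "borel_action (G\<lparr>carrier := D\<rparr>) (subtopology T D) X \<phi>"
  obtains \<psi> where
    "borel_action G T (prod_topology X (discrete_topology (rcosets\<^bsub>G\<^esub> D))) \<psi>"
    "\<And>x C y C'. ((x, C), (y, C'))
        \<in> orbit_eqrel G (prod_topology X (discrete_topology (rcosets\<^bsub>G\<^esub> D))) \<psi> \<longleftrightarrow>
      (x, y) \<in> orbit_eqrel (G\<lparr>carrier := D\<rparr>) X \<phi> \<and> C \<in> rcosets\<^bsub>G\<^esub> D \<and> C' \<in> rcosets\<^bsub>G\<^esub> D"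
proof -
  interpret G: group G
    using G by (rule topological_group_imp_group)
  interpret A: group_action "G\<lparr>carrier := D\<rparr>" "topspace X" \<phi>
    using act by (simp add: borel_action_def)
  have top: "topspace T = carrier G"
    using G by (rule topspace_topological_group)
  have Dsub: "D \<subseteq> carrier G"
    using D by (rule subgroup.subset)
  define Q where "Q = rcosets\<^bsub>G\<^esub> D"
  \<comment> \<open>An arbitrary choice of representatives is harmless: the coset space is discrete,
    so \<open>s\<close> is continuous on it.\<close>
  define s where "s C = (SOME g. g \<in> carrier G \<and> C = D #>\<^bsub>G\<^esub> g)" for C
  have "s C \<in> carrier G \<and> C = D #>\<^bsub>G\<^esub> s C" if "C \<in> Q" for C
  proof -
    have "\<exists>g. g \<in> carrier G \<and> C = D #>\<^bsub>G\<^esub> g"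
      using that by (auto simp: Q_def RCOSETS_def)
    then show ?thesis
      unfolding s_def by (rule someI_ex)
  qed
  then have s: "\<And>C. C \<in> Q \<Longrightarrow> s C \<in> carrier G" and sC: "\<And>C. C \<in> Q \<Longrightarrow> D #>\<^bsub>G\<^esub> s C = C"
    by auto
  have Q_sub: "C \<subseteq> carrier G" if "C \<in> Q" for C
    using G.rcosets_subset_PowG[OF D] that by (auto simp: Q_def)
  have tr: "C #>\<^bsub>G\<^esub> inv\<^bsub>G\<^esub> g = D #>\<^bsub>G\<^esub> (s C \<otimes>\<^bsub>G\<^esub> inv\<^bsub>G\<^esub> g)" if "C \<in> Q" "g \<in> carrier G" for C g
    using G.coset_mult_assoc[OF Dsub s[OF that(1)] G.inv_closed[OF that(2)]] sC[OF that(1)] by simp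
  have trQ: "C #>\<^bsub>G\<^esub> inv\<^bsub>G\<^esub> g \<in> Q" if "C \<in> Q" "g \<in> carrier G" for C g
    using that s by (auto simp: tr Q_def RCOSETS_def)
  \<comment> \<open>The element tested for membership in \<open>D\<close> is the value of the
    cocycle whenever the test succeeds. One expression thus decides where \<open>g\<close> sends the
    coset and how it acts on \<open>X\<close>.\<close>
  have tr_iff: "C #>\<^bsub>G\<^esub> inv\<^bsub>G\<^esub> g = C' \<longleftrightarrow> s C' \<otimes>\<^bsub>G\<^esub> g \<otimes>\<^bsub>G\<^esub> inv\<^bsub>G\<^esub> (s C) \<in> D"
    if C: "C \<in> Q" "C' \<in> Q" and g: "g \<in> carrier G" for C C' g
  proof -
    have "C #>\<^bsub>G\<^esub> inv\<^bsub>G\<^esub> g = C' \<longleftrightarrow> D #>\<^bsub>G\<^esub> (s C \<otimes>\<^bsub>G\<^esub> inv\<^bsub>G\<^esub> g) = D #>\<^bsub>G\<^esub> s C'"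
      using tr[OF C(1) g] sC[OF C(2)] by simp
    also have "\<dots> \<longleftrightarrow> s C' \<otimes>\<^bsub>G\<^esub> inv\<^bsub>G\<^esub> (s C \<otimes>\<^bsub>G\<^esub> inv\<^bsub>G\<^esub> g) \<in> D"
      using C g s by (intro G.rcos_eq_iff[OF D]) simp_all
    also have "s C' \<otimes>\<^bsub>G\<^esub> inv\<^bsub>G\<^esub> (s C \<otimes>\<^bsub>G\<^esub> inv\<^bsub>G\<^esub> g) = s C' \<otimes>\<^bsub>G\<^esub> g \<otimes>\<^bsub>G\<^esub> inv\<^bsub>G\<^esub> (s C)"
      using C g s by (simp add: G.inv_mult_group G.m_assoc)
    finally show ?thesis .
  qed
  define c where "c g C = s (C #>\<^bsub>G\<^esub> inv\<^bsub>G\<^esub> g) \<otimes>\<^bsub>G\<^esub> g \<otimes>\<^bsub>G\<^esub> inv\<^bsub>G\<^esub> (s C)" for g C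
  have cD: "c g C \<in> D" if "C \<in> Q" "g \<in> carrier G" for g C
    unfolding c_def using tr_iff[OF that(1) trQ[OF that] that(2)] by blast
  have tr_mult: "(C #>\<^bsub>G\<^esub> inv\<^bsub>G\<^esub> h) #>\<^bsub>G\<^esub> inv\<^bsub>G\<^esub> g = C #>\<^bsub>G\<^esub> inv\<^bsub>G\<^esub> (g \<otimes>\<^bsub>G\<^esub> h)"
    if "C \<in> Q" "g \<in> carrier G" "h \<in> carrier G" for C g h
    using that Q_sub[OF that(1)] by (simp add: G.coset_mult_assoc G.inv_mult_group)
  \<comment> \<open>The cocycle identity: the representative of the intermediate coset occurs
    inverted in the left factor and plain in the right one, and cancels.\<close>
  have c_mult: "c (g \<otimes>\<^bsub>G\<^esub> h) C = c g (C #>\<^bsub>G\<^esub> inv\<^bsub>G\<^esub> h) \<otimes>\<^bsub>G\<^esub> c h C"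
    if C: "C \<in> Q" and gh: "g \<in> carrier G" "h \<in> carrier G" for C g h
  proof -
    let ?C1 = "C #>\<^bsub>G\<^esub> inv\<^bsub>G\<^esub> h" and ?C2 = "C #>\<^bsub>G\<^esub> inv\<^bsub>G\<^esub> (g \<otimes>\<^bsub>G\<^esub> h)"
    have "s C \<in> carrier G" "s ?C1 \<in> carrier G" "s ?C2 \<in> carrier G"
      using C gh by (simp_all add: s trQ)
    moreover from this have "inv\<^bsub>G\<^esub> s ?C1 \<otimes>\<^bsub>G\<^esub> (s ?C1 \<otimes>\<^bsub>G\<^esub> (h \<otimes>\<^bsub>G\<^esub> inv\<^bsub>G\<^esub> s C)) = h \<otimes>\<^bsub>G\<^esub> inv\<^bsub>G\<^esub> s C"
      using gh by (simp flip: G.m_assoc)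
    ultimately show ?thesis
      using gh unfolding c_def tr_mult[OF C gh] by (simp add: G.m_assoc)
  qed
  have \<phi>_cl: "\<phi> d x \<in> topspace X" if "d \<in> D" "x \<in> topspace X" for d x
    using that A.element_image[of d x] by simp
  define Y where "Y = prod_topology X (discrete_topology Q)"
  have topY: "topspace Y = topspace X \<times> Q"
    by (simp add: Y_def)
  define \<psi> where "\<psi> g = (\<lambda>z\<in>topspace X \<times> Q. (\<phi> (c g (snd z)) (fst z), snd z #>\<^bsub>G\<^esub> inv\<^bsub>G\<^esub> g))" for g
  have \<psi>: "\<psi> g (x, C) = (\<phi> (c g C) x, C #>\<^bsub>G\<^esub> inv\<^bsub>G\<^esub> g)" if "x \<in> topspace X" "C \<in> Q" for g x C
    using that by (simp add: \<psi>_def)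
  have "group_action G (topspace Y) \<psi>"
    unfolding topY
  proof (rule group_actionI[OF G.is_group])
    show "\<psi> g \<in> extensional (topspace X \<times> Q)" for g
      by (simp add: \<psi>_def)
    fix g z assume g: "g \<in> carrier G" and "z \<in> topspace X \<times> Q"
    then obtain x C where z: "z = (x, C)" "x \<in> topspace X" "C \<in> Q"
      by auto
    show "\<psi> g z \<in> topspace X \<times> Q"
      using g z by (simp add: \<psi> \<phi>_cl cD trQ)
    fix h assume h: "h \<in> carrier G"
    show "\<psi> (h \<otimes>\<^bsub>G\<^esub> g) z = \<psi> h (\<psi> g z)"
    proof -
      have "\<phi> (c h (C #>\<^bsub>G\<^esub> inv\<^bsub>G\<^esub> g) \<otimes>\<^bsub>G\<^esub> c g C) x = \<phi> (c h (C #>\<^bsub>G\<^esub> inv\<^bsub>G\<^esub> g)) (\<phi> (c g C) x)"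
        using A.composition_rule[of x "c h (C #>\<^bsub>G\<^esub> inv\<^bsub>G\<^esub> g)" "c g C"] g h z by (simp add: cD trQ)
      then show ?thesis
        using g h z by (simp add: \<psi> \<phi>_cl cD trQ c_mult tr_mult)
    qed
  next
    fix z assume "z \<in> topspace X \<times> Q"
    then obtain x C where z: "z = (x, C)" "x \<in> topspace X" "C \<in> Q"
      by auto
    have tr1: "C #>\<^bsub>G\<^esub> inv\<^bsub>G\<^esub> \<one>\<^bsub>G\<^esub> = C"
      using Q_sub[OF z(3)] by simp
    have "c \<one>\<^bsub>G\<^esub> C = \<one>\<^bsub>G\<^esub>"
      using s[OF z(3)] by (simp add: c_def tr1 del: G.inv_one)
    moreover have "\<phi> \<one>\<^bsub>G\<^esub> x = x"
      using fun_cong[OF A.id_eq_one, of x] z(2) by simp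
    ultimately show "\<psi> \<one>\<^bsub>G\<^esub> z = z"
      using z tr1 by (simp add: \<psi>)
  qed
  moreover have "(\<lambda>(g, z). \<psi> g z) \<in> measurable (borel_of (prod_topology T Y)) (borel_of Y)"
  proof -
    let ?Z = "prod_topology T Y"
    have c1: "continuous_map ?Z T (\<lambda>w. fst w)"
      by (rule continuous_map_fst)
    have c2: "continuous_map ?Z X (\<lambda>w. fst (snd w))"
      using continuous_map_compose[OF continuous_map_snd[of T Y]
          continuous_map_fst[of X "discrete_topology Q", folded Y_def]]
      by (simp add: o_def)
    have c3: "continuous_map ?Z (discrete_topology Q) (\<lambda>w. snd (snd w))"
      using continuous_map_compose[OF continuous_map_snd[of T Y]
          continuous_map_snd[of X "discrete_topology Q", folded Y_def]]
      by (simp add: o_def)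
    let ?m = "\<lambda>C C' g. s C' \<otimes>\<^bsub>G\<^esub> g \<otimes>\<^bsub>G\<^esub> inv\<^bsub>G\<^esub> (s C)"
    \<comment> \<open>The piece on which the coset moves from \<open>C\<close> to \<open>C'\<close>.
      There both cosets are constant and the cocycle is the continuous map \<open>?m C C'\<close>.
      There are countably many pieces, all closed.\<close>
    define P where "P C C' = {w \<in> topspace ?Z. snd (snd w) = C \<and> ?m C C' (fst w) \<in> D}" for C C'
    have cm: "continuous_map ?Z T (\<lambda>w. ?m C C' (fst w))" if "C \<in> Q" "C' \<in> Q" for C C'
      by (intro continuous_map_group_mult[OF G] c1) (simp_all add: s that top)
    show ?thesis
    proof (rule measurable_piecewise_restrict)
      show "countable ((\<lambda>(C, C'). P C C') ` (Q \<times> Q))"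
        using count by (intro countable_image countable_SIGMA) (simp_all add: Q_def)
      fix \<Omega> assume "\<Omega> \<in> (\<lambda>(C, C'). P C C') ` (Q \<times> Q)"
      then obtain C C' where C: "C \<in> Q" "C' \<in> Q" and \<Omega>: "\<Omega> = P C C'"
        by auto
      have "closedin ?Z {w \<in> topspace ?Z. snd (snd w) \<in> {C}}"
        using C by (intro closedin_continuous_map_preimage[OF c3]) simp
      moreover have "closedin ?Z {w \<in> topspace ?Z. ?m C C' (fst w) \<in> D}"
        by (rule closedin_continuous_map_preimage[OF cm[OF C] closed])
      ultimately have "closedin ?Z ({w \<in> topspace ?Z. snd (snd w) \<in> {C}} \<inter>
          {w \<in> topspace ?Z. ?m C C' (fst w) \<in> D})"
        by (rule closedin_Int)
      also have "{w \<in> topspace ?Z. snd (snd w) \<in> {C}} \<inter> {w \<in> topspace ?Z. ?m C C' (fst w) \<in> D}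
          = P C C'"
        unfolding P_def by blast
      finally have cl: "closedin ?Z (P C C')" .
      then have "P C C' \<inter> space (borel_of ?Z) = P C C'"
        using closedin_subset by fastforce
      then show "\<Omega> \<inter> space (borel_of ?Z) \<in> sets (borel_of ?Z)"
        using closedin_sets_borel_of[OF cl] by (simp only: \<Omega>)
      have topP: "topspace (subtopology ?Z (P C C')) = P C C'"
        using closedin_subset[OF cl] by (rule topspace_subtopology_subset)
      \<comment> \<open>On this piece the cocycle takes values in \<open>D\<close>, so it is
        continuous into the subspace on which the action \<phi> is Borel.\<close>
      have "continuous_map (subtopology ?Z (P C C')) (subtopology T D) (\<lambda>w. ?m C C' (fst w))"
        by (rule continuous_map_into_subtopology[OF continuous_map_from_subtopology[OF cm[OF C]]])
          (unfold topP, simp add: P_def)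
      then have "continuous_map (subtopology ?Z (P C C')) (prod_topology (subtopology T D) X)
          (\<lambda>w. (?m C C' (fst w), fst (snd w)))"
        unfolding continuous_map_paired using continuous_map_from_subtopology[OF c2] by (rule conjI)
      then have m1: "(\<lambda>w. (?m C C' (fst w), fst (snd w)))
          \<in> measurable (borel_of (subtopology ?Z (P C C'))) (borel_of (prod_topology (subtopology T D) X))"
        by (rule continuous_map_measurable_borel_of)
      have m2: "(\<lambda>(g, x). \<phi> g x) \<in> measurable (borel_of (prod_topology (subtopology T D) X)) (borel_of X)"
        using act by (simp add: borel_action_def)
      have "continuous_map X Y (\<lambda>x. (x, C'))"
        unfolding Y_def continuous_map_paired using C by simp
      then have m3: "(\<lambda>x. (x, C')) \<in> measurable (borel_of X) (borel_of Y)"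
        by (rule continuous_map_measurable_borel_of)
      have "(\<lambda>w. (\<phi> (?m C C' (fst w)) (fst (snd w)), C'))
          \<in> measurable (borel_of (subtopology ?Z (P C C'))) (borel_of Y)"
        using measurable_comp[OF measurable_comp[OF m1 m2] m3] by (simp add: o_def)
      then have "(\<lambda>w. (\<phi> (?m C C' (fst w)) (fst (snd w)), C'))
          \<in> measurable (restrict_space (borel_of ?Z) (P C C')) (borel_of Y)"
        by (rule measurable_restrict_space_borel_of)
      moreover have "(case w of (g, z) \<Rightarrow> \<psi> g z) = (\<phi> (?m C C' (fst w)) (fst (snd w)), C')"
        if "w \<in> space (restrict_space (borel_of ?Z) (P C C'))" for w
      proof -
        obtain g x E where w: "w = (g, x, E)"
          by (cases w) auto
        have "w \<in> P C C'"
          using that by (simp add: space_restrict_space)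
        then have gx: "g \<in> carrier G" "x \<in> topspace X" "E = C" "?m C C' g \<in> D"
          by (auto simp: P_def w topY top)
        then have "C #>\<^bsub>G\<^esub> inv\<^bsub>G\<^esub> g = C'"
          using tr_iff C by blast
        then show ?thesis
          using gx C by (simp add: w \<psi> c_def)
      qed
      ultimately show "(\<lambda>(g, z). \<psi> g z) \<in> measurable (restrict_space (borel_of ?Z) \<Omega>) (borel_of Y)"
        unfolding \<Omega> by (subst measurable_cong)
    next
      show "space (borel_of ?Z) \<subseteq> \<Union>((\<lambda>(C, C'). P C C') ` (Q \<times> Q))"
      proof
        fix w assume w: "w \<in> space (borel_of ?Z)"
        obtain g x C where gxC: "w = (g, x, C)"
          by (cases w) auto
        then have g: "g \<in> carrier G" "C \<in> Q"
          using w by (auto simp: topY top)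
        \<comment> \<open>The pieces cover the space: the target coset is read off from the point
          itself.\<close>
        then have "w \<in> P C (C #>\<^bsub>G\<^esub> inv\<^bsub>G\<^esub> g)"
          using w cD[OF g(2,1)] by (simp add: P_def c_def gxC)
        then show "w \<in> \<Union>((\<lambda>(C, C'). P C C') ` (Q \<times> Q))"
          using g trQ by blast
      qed
    qed
  qed
  ultimately have "borel_action G T Y \<psi>"
    by (simp add: borel_action_def)
  moreover have "((x, C), (y, C')) \<in> orbit_eqrel G Y \<psi> \<longleftrightarrow>
      (x, y) \<in> orbit_eqrel (G\<lparr>carrier := D\<rparr>) X \<phi> \<and> C \<in> Q \<and> C' \<in> Q" for x C y C'
  proof
    assume "((x, C), (y, C')) \<in> orbit_eqrel G Y \<psi>"
    then obtain g where g: "x \<in> topspace X" "C \<in> Q" "g \<in> carrier G" "(y, C') = \<psi> g (x, C)"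
      by (auto simp: orbit_eqrel_def orbit_def topY)
    then have "y = \<phi> (c g C) x" "C' = C #>\<^bsub>G\<^esub> inv\<^bsub>G\<^esub> g"
      by (simp_all add: \<psi>)
    then show "(x, y) \<in> orbit_eqrel (G\<lparr>carrier := D\<rparr>) X \<phi> \<and> C \<in> Q \<and> C' \<in> Q"
      using g cD trQ by (auto simp: orbit_eqrel_def orbit_def)
  next
    assume "(x, y) \<in> orbit_eqrel (G\<lparr>carrier := D\<rparr>) X \<phi> \<and> C \<in> Q \<and> C' \<in> Q"
    then obtain d where d: "x \<in> topspace X" "d \<in> D" "y = \<phi> d x" and C: "C \<in> Q" "C' \<in> Q"
      by (auto simp: orbit_eqrel_def orbit_def)
    \<comment> \<open>Chosen so that \<open>s C' g (s C)\<^sup>-\<^sup>1 = d\<close>: then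
      \<open>g\<close> takes \<open>C\<close> to \<open>C'\<close> and its cocycle at
      \<open>C\<close> is \<open>d\<close>.\<close>
    define g where "g = inv\<^bsub>G\<^esub> (s C') \<otimes>\<^bsub>G\<^esub> d \<otimes>\<^bsub>G\<^esub> s C"
    have dG: "d \<in> carrier G"
      using d(2) Dsub by blast
    then have g: "g \<in> carrier G"
      using C by (simp add: g_def s)
    have "s C' \<otimes>\<^bsub>G\<^esub> (inv\<^bsub>G\<^esub> s C' \<otimes>\<^bsub>G\<^esub> d) = d"
      using C dG by (simp add: s flip: G.m_assoc)
    then have gd: "s C' \<otimes>\<^bsub>G\<^esub> g \<otimes>\<^bsub>G\<^esub> inv\<^bsub>G\<^esub> (s C) = d"
      using C dG by (simp add: g_def s G.m_assoc)
    then have "C #>\<^bsub>G\<^esub> inv\<^bsub>G\<^esub> g = C'"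
      using tr_iff[OF C g] d(2) by simp
    then have "\<psi> g (x, C) = (y, C')"
      using gd d C by (simp add: \<psi> c_def)
    then show "((x, C), (y, C')) \<in> orbit_eqrel G Y \<psi>"
      using g d(1) C(1) by (force simp: orbit_eqrel_def orbit_def topY)
  qed
  ultimately show ?thesis
    using that unfolding Y_def Q_def by blast
qed

lemma graphic_polish_group_closed_subgroup:
  assumes G: "graphic_polish_group G T" and D: "subgroup D G" and closed: "closedin T D"
    and count: "countable (rcosets\<^bsub>G\<^esub> D)"
  shows "graphic_polish_group (G\<lparr>carrier := D\<rparr>) (subtopology T D)"
  unfolding graphic_polish_group_def
proof (intro conjI allI impI)
  have tg: "topological_group G T" and pol: "polish_top T"
    using G by (simp_all add: graphic_polish_group_def polish_group_def)
  interpret G: group G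
    using tg by (rule topological_group_imp_group)
  show "polish_group (G\<lparr>carrier := D\<rparr>) (subtopology T D)"
    using topological_group_subgroup[OF tg D] polish_top_closed_subtopology[OF pol closed]
    by (simp add: polish_group_def)
  fix X :: "nat set topology" and \<phi>
  assume X: "polish_top X \<and> borel_action (G\<lparr>carrier := D\<rparr>) (subtopology T D) X \<phi>"
  define Q where "Q = rcosets\<^bsub>G\<^esub> D"
  define Y where "Y = prod_topology X (discrete_topology Q)"
  let ?E = "orbit_eqrel (G\<lparr>carrier := D\<rparr>) X \<phi>"
  interpret A: group_action "G\<lparr>carrier := D\<rparr>" "topspace X" \<phi>
    using X by (simp add: borel_action_def)
  obtain \<psi> where \<psi>: "borel_action G T Y \<psi>"
    and orb: "\<And>x C y C'. ((x, C), (y, C')) \<in> orbit_eqrel G Y \<psi> \<longleftrightarrow> (x, y) \<in> ?E \<and> C \<in> Q \<and> C' \<in> Q"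
    using induced_borel_action[OF tg D closed count conjunct2[OF X]] unfolding Y_def Q_def by metis
  have "polish_top Y"
    using X count by (simp add: Y_def Q_def polish_top_prod_topology polish_top_discrete_topology)
  \<comment> \<open>The points of \<open>Y\<close> are pairs with a coset, so graphicness is needed
    for spaces over an arbitrary type.\<close>
  then have "borel_graphable Y (orbit_eqrel G Y \<psi>)"
    using \<psi> by (rule graphic_polish_group_any_space[OF G])
  then obtain R where R: "borel_graph Y R" and conn: "orbit_eqrel G Y \<psi> = connectedness_rel Y R"
    by (auto simp: borel_graphable_def)
  have Rsets: "R \<in> sets (borel_of (prod_topology Y Y))"
    using R by (simp add: borel_graph_def)
  have Rsub: "R \<subseteq> topspace Y \<times> topspace Y"
    using sets.sets_into_space[OF Rsets] by simp
  have RE: "R \<subseteq> orbit_eqrel G Y \<psi>"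
    using Rsub by (auto simp: conn connectedness_rel_def)
  \<comment> \<open>The image of \<open>R\<close> under the projection to \<open>X\<close>, without
    the loops that come from edges between two points over the same \<open>x\<close>.\<close>
  define S where "S = {(x, y). x \<noteq> y \<and> (\<exists>C\<in>Q. \<exists>C'\<in>Q. ((x, C), (y, C')) \<in> R)}"
  have Ssub: "S \<subseteq> ?E"
    using RE orb by (auto simp: S_def)
  have "S \<in> sets (borel_of (prod_topology X X))"
  proof -
    \<comment> \<open>The slice of \<open>R\<close> at a fixed pair of cosets, a preimage of
      \<open>R\<close> under a continuous map. Countably many slices make up the projection.\<close>
    define F where "F C C' = {z \<in> topspace (prod_topology X X). ((fst z, C), (snd z, C')) \<in> R}" for C C'
    have F: "F C C' \<in> sets (borel_of (prod_topology X X))" if "C \<in> Q" "C' \<in> Q" for C C'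
    proof -
      have "continuous_map (prod_topology X X) (prod_topology Y Y) (\<lambda>z. ((fst z, C), (snd z, C')))"
        unfolding Y_def continuous_map_paired
        by (intro conjI continuous_map_fst continuous_map_snd) (simp_all add: that)
      then have "(\<lambda>z. ((fst z, C), (snd z, C'))) -` R \<inter> space (borel_of (prod_topology X X))
          \<in> sets (borel_of (prod_topology X X))"
        by (rule measurable_sets[OF continuous_map_measurable_borel_of Rsets])
      moreover have "(\<lambda>z. ((fst z, C), (snd z, C'))) -` R \<inter> space (borel_of (prod_topology X X)) = F C C'"
        unfolding F_def space_borel_of by blast
      ultimately show ?thesis
        by simp
    qed
    have Q: "countable Q"
      using count by (simp add: Q_def)
    have "(\<Union>C\<in>Q. \<Union>C'\<in>Q. F C C') \<in> sets (borel_of (prod_topology X X))"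
      using F by (intro sets.countable_UN'[OF Q] image_subsetI)
    \<comment> \<open>Removing the loops preserves Borelness because the diagonal of a Hausdorff
      space is closed.\<close>
    moreover have "(\<lambda>x. (x, x)) ` topspace X \<in> sets (borel_of (prod_topology X X))"
      using polish_top_imp_Hausdorff_space[OF conjunct1[OF X]]
      unfolding Hausdorff_space_closedin_diagonal by (rule closedin_sets_borel_of)
    moreover have "S = (\<Union>C\<in>Q. \<Union>C'\<in>Q. F C C') - (\<lambda>x. (x, x)) ` topspace X"
      using Rsub by (fastforce simp: S_def F_def Y_def)
    ultimately show ?thesis
      by auto
  qed
  moreover have "sym S"
  proof (rule symI)
    have "sym R"
      using R by (simp add: borel_graph_def)
    then show "(y, x) \<in> S" if "(x, y) \<in> S" for x y
      using that unfolding S_def by (blast dest: symD)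
  qed
  moreover have "irrefl S"
    by (simp add: S_def irrefl_def)
  moreover have "?E = connectedness_rel X S"
  proof (intro equalityI subrelI)
    fix x y assume xy: "(x, y) \<in> ?E"
    \<comment> \<open>An edge of \<open>R\<close> projects to an edge of \<open>S\<close> or
      collapses to a point, so paths project to paths.\<close>
    have lift: "(fst z, fst w) \<in> S\<^sup>*" if "(z, w) \<in> R\<^sup>*" for z w
      using that
    proof induction
      case (step u v)
      have "fst u = fst v \<or> (fst u, fst v) \<in> S"
        using step.hyps(2) Rsub by (cases u; cases v) (auto simp: S_def Y_def)
      with step.IH show ?case
        by (auto intro: rtrancl_into_rtrancl)
    qed simp
    \<comment> \<open>The orbit relation upstairs ignores cosets, so \<open>x\<close> and
      \<open>y\<close> may both be lifted to the coset of the unit.\<close>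
    have "D #>\<^bsub>G\<^esub> \<one>\<^bsub>G\<^esub> \<in> Q"
      by (auto simp: Q_def RCOSETS_def)
    then have "((x, D #>\<^bsub>G\<^esub> \<one>\<^bsub>G\<^esub>), (y, D #>\<^bsub>G\<^esub> \<one>\<^bsub>G\<^esub>)) \<in> R\<^sup>*"
      using orb xy conn by (auto simp: connectedness_rel_def)
    from lift[OF this] show "(x, y) \<in> connectedness_rel X S"
      using A.orbit_eqrelD[OF xy] by (simp add: connectedness_rel_def)
  next
    fix x y assume "(x, y) \<in> connectedness_rel X S"
    then show "(x, y) \<in> ?E"
      using A.rtrancl_subset_orbit_eqrel[OF refl Ssub] by (simp add: connectedness_rel_def)
  qed
  ultimately show "borel_graphable X ?E"
    by (auto simp: borel_graphable_def borel_graph_def)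
qed

theorem theorem4p3:
  shows
    "(\<forall>(G :: 'a monoid) T (Hs :: 'a set list).
        polish_group G T \<and> Hs \<noteq> [] \<and>
        (\<forall>H\<in>set Hs. subgroup H G \<and>
           graphic_polish_group (G\<lparr>carrier := H\<rparr>) (subtopology T H)) \<and>
        carrier G = foldr (\<lambda>H K. H <#>\<^bsub>G\<^esub> K) Hs {\<one>\<^bsub>G\<^esub>} \<longrightarrow>
        graphic_polish_group G T) \<and>
     (\<forall>(I :: 'i set) (G :: 'i \<Rightarrow> 'a monoid) T.
        finite I \<and> (\<forall>i\<in>I. graphic_polish_group (G i) (T i)) \<longrightarrow>
        graphic_polish_group (product_group I G) (product_topology T I)) \<and>
     (\<forall>(N :: 'a monoid) TN (H :: 'b monoid) TH \<alpha>.
        graphic_polish_group N TN \<and> graphic_polish_group H TH \<and>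
        \<alpha> \<in> hom H (AutoGroup N) \<and>
        continuous_map (prod_topology TH TN) TN (\<lambda>(h, n). \<alpha> h n) \<longrightarrow>
        graphic_polish_group (semidirect_product N H \<alpha>) (prod_topology TN TH)) \<and>
     (\<forall>(G :: 'a monoid) T (H :: nat \<Rightarrow> 'a set).
        polish_group G T \<and>
        (\<forall>n\<ge>1. subgroup (H n) G \<and>
           graphic_polish_group (G\<lparr>carrier := H n\<rparr>) (subtopology T (H n))) \<and>
        carrier G = (\<Union>n\<in>{1..}. H n) \<longrightarrow>
        graphic_polish_group G T) \<and>
     (\<forall>(G :: 'a monoid) T N (Q :: 'b monoid) TQ f.
        graphic_polish_group G T \<and> N \<lhd> G \<and> polish_group Q TQ \<and>
        f \<in> iso (G Mod N) Q \<and> quotient_map T TQ (\<lambda>g. f (N #>\<^bsub>G\<^esub> g)) \<longrightarrow>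
        graphic_polish_group Q TQ) \<and>
     (\<forall>(G :: 'a monoid) T D.
        graphic_polish_group G T \<and> subgroup D G \<and> closedin T D \<and>
        countable (rcosets\<^bsub>G\<^esub> D) \<longrightarrow>
        graphic_polish_group (G\<lparr>carrier := D\<rparr>) (subtopology T D))"
  (is "?internal \<and> ?prod \<and> ?semidirect \<and> ?union \<and> ?quotient \<and> ?closed")
proof (intro conjI)
  show ?internal
    by (intro allI impI, elim conjE, rule graphic_polish_group_internal_product) simp_all
  show ?prod
    by (intro allI impI, elim conjE, rule graphic_polish_group_product_group) simp_all
  show ?semidirect
    by (intro allI impI, elim conjE, rule graphic_polish_group_semidirect_product)
  show ?union
  proof (intro allI impI, elim conjE)
    fix G :: "'a monoid" and T and H :: "nat \<Rightarrow> 'a set"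
    assume G: "polish_group G T" "carrier G = (\<Union>n\<in>{1..}. H n)"
      and H: "\<forall>n\<ge>1. subgroup (H n) G \<and>
        graphic_polish_group (G\<lparr>carrier := H n\<rparr>) (subtopology T (H n))"
    show "graphic_polish_group G T"
      \<comment> \<open>The index set starts at 1, since nothing is assumed about
        \<open>H 0\<close>.\<close>
      by (rule graphic_polish_group_countable_Union[of G T "{1..}" H]) (use G H in simp_all)
  qed
  show ?quotient
    by (intro allI impI, elim conjE, rule graphic_polish_group_quotient)
  show ?closed
    by (intro allI impI, elim conjE, rule graphic_polish_group_closed_subgroup)
qed

end
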